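(* Let $d=1$ and let $a:\mathbb{R}\to\mathbb{C}$ satisfy $a\in L^\infty(\mathbb{R})\cap L^1(\mathbb{R})$. If $\|a\|_{L^1(\mathbb{R})}<2$, then the damped wave operator $A_a$ has no eigenvalues, i.e. $\sigma_{\mathrm{p}}(A_a)=\varnothing$. Moreover, the constant $2$ is optimal, i.e. it cannot be replaced by any larger constant: for every $c>2$ there exists $a\in L^\infty(\mathbb{R})\cap L^1(\mathbb{R})$ with $\|a\|_{L^1(\mathbb{R})}<c$ such that $\sigma_{\mathrm{p}}(A_a)\neq\varnothing$.
   Context: All function spaces consist of complex-valued functions. $\dot H^1(\mathbb{R}^d)$ denotes the completion of $C_0^\infty(\mathbb{R}^d)$ with respect to the norm $\psi\mapsto\|\nabla\psi\|_{L^2(\mathbb{R}^d)}$; the gradient extends to an isometry of $\dot H^1(\mathbb{R}^d)$ into $L^2(\mathbb{R}^d)^d$, $\Delta\psi$ for $\psi\in\dot H^1(\mathbb{R}^d)$ is the distributional divergence of $\nabla\psi$, and $H^1(\mathbb{R}^d)$ is naturally (injectively) contained in $\dot H^1(\mathbb{R}^d)$. For a damping $a\in L^\infty(\mathbb{R}^d)$ (possibly complex-valued), the damped wave operator $A_a$ acts in the Hilbert space $\mathcal{H}:=\dot H^1(\mathbb{R}^d)\times L^2(\mathbb{R}^d)$ (with norm $\|(\psi_1,\psi_2)\|^2=\|\nabla\psi_1\|^2_{L^2}+\|\psi_2\|_{L^2}^2$) by $$A_a\begin{pmatrix}\psi_1\\ \psi_2\end{pmatrix}:=\begin{pmatrix}\psi_2\\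 \Delta\psi_1-a\,\psi_2\end{pmatrix},\qquad \operatorname{dom}A_a:=\{\psi_1\in\dot H^1(\mathbb{R}^d):\Delta\psi_1\in L^2(\mathbb{R}^d)\}\times H^1(\mathbb{R}^d).$$ This is the closure of the operator given by the same formula on $H^2(\mathbb{R}^d)\times H^1(\mathbb{R}^d)$. The point spectrum $\sigma_{\mathrm{p}}(A_a)$ is the set of eigenvalues $\mu\in\mathbb{C}$, i.e. those for which $A_a\Psi=\mu\Psi$ for some nonzero $\Psi\in\operatorname{dom}A_a$. Here $d=1$. *)

theory Defs
  imports "HOL-Analysis.Analysis"
begin

section \<open>The space \<open>L\<^sup>2\<close> of complex-valued functions on the real line\<close>

definition square_integrable :: "(real \<Rightarrow> complex) \<Rightarrow> bool" where
  "square_integrable f \<longleftrightarrow>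
     f \<in> borel_measurable lebesgue \<and> integrable lebesgue (\<lambda>x. (cmod (f x))\<^sup>2)"

definition L2_norm :: "(real \<Rightarrow> complex) \<Rightarrow> real" where
  "L2_norm f = sqrt (LINT x|lebesgue. (cmod (f x))\<^sup>2)"

definition ess_bounded :: "(real \<Rightarrow> complex) \<Rightarrow> bool" where
  "ess_bounded a \<longleftrightarrow>
     a \<in> borel_measurable lebesgue \<and> (\<exists>C. AE x in lebesgue. cmod (a x) \<le> C)"

lemma sq_norm_add_le: "(cmod (a + b))\<^sup>2 \<le> 2 * (cmod a)\<^sup>2 + 2 * (cmod b)\<^sup>2"
proof -
  have "(cmod (a + b))\<^sup>2 \<le> (cmod a + cmod b)\<^sup>2"
    by (intro power_mono norm_triangle_ineq norm_ge_zero)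
  also have "\<dots> \<le> 2 * (cmod a)\<^sup>2 + 2 * (cmod b)\<^sup>2"
    using zero_le_power2[of "cmod a - cmod b"] by (simp add: power2_eq_square algebra_simps)
  finally show ?thesis .
qed

lemma square_integrable_zero: "square_integrable (\<lambda>x. 0)"
  by (simp add: square_integrable_def)

lemma square_integrable_scale:
  "square_integrable f \<Longrightarrow> square_integrable (\<lambda>x. c * f x)"
  by (auto simp: square_integrable_def norm_mult power_mult_distrib)

lemma square_integrable_add:
  assumes "square_integrable f" "square_integrable g"
  shows "square_integrable (\<lambda>x. f x + g x)"
  unfolding square_integrable_def
proof
  have [measurable]: "f \<in> borel_measurable lebesgue" "g \<in> borel_measurable lebesgue"
    using assms by (auto simp: square_integrable_def)
  show "(\<lambda>x. f x + g x) \<in> borel_measurable lebesgue" by measurable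
  show "integrable lebesgue (\<lambda>x. (cmod (f x + g x))\<^sup>2)"
  proof (rule Bochner_Integration.integrable_bound)
    show "integrable lebesgue (\<lambda>x. 2 * (cmod (f x))\<^sup>2 + 2 * (cmod (g x))\<^sup>2)"
      using assms by (auto simp: square_integrable_def)
  qed (auto simp: sq_norm_add_le)
qed

lemma square_integrable_diff:
  "square_integrable f \<Longrightarrow> square_integrable g \<Longrightarrow> square_integrable (\<lambda>x. f x - g x)"
  using square_integrable_add[of f "\<lambda>x. (-1) * g x"] square_integrable_scale[of g "-1"] by simp

lemma square_integrable_mult:
  assumes "ess_bounded a" "square_integrable f"
  shows "square_integrable (\<lambda>x. a x * f x)"
  unfolding square_integrable_def
proof
  have [measurable]: "a \<in> borel_measurable lebesgue" "f \<in> borel_measurable lebesgue"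
    using assms by (auto simp: square_integrable_def ess_bounded_def)
  show "(\<lambda>x. a x * f x) \<in> borel_measurable lebesgue" by measurable
  obtain C where C: "AE x in lebesgue. cmod (a x) \<le> C"
    using assms by (auto simp: ess_bounded_def)
  show "integrable lebesgue (\<lambda>x. (cmod (a x * f x))\<^sup>2)"
  proof (rule Bochner_Integration.integrable_bound)
    show "integrable lebesgue (\<lambda>x. C\<^sup>2 * (cmod (f x))\<^sup>2)"
      using assms by (auto simp: square_integrable_def)
    show "AE x in lebesgue. norm ((cmod (a x * f x))\<^sup>2) \<le> norm (C\<^sup>2 * (cmod (f x))\<^sup>2)"
      using C by eventually_elim
        (auto simp: norm_mult power_mult_distrib intro!: mult_right_mono power_mono)
  qed measurable
qed

lemma L2_norm_nonneg: "0 \<le> L2_norm f"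
  by (simp add: L2_norm_def)

lemma L2_norm_minus_commute: "L2_norm (\<lambda>x. f x - g x) = L2_norm (\<lambda>x. g x - f x)"
  by (simp add: L2_norm_def norm_minus_commute)

lemma L2_norm_scale: "L2_norm (\<lambda>x. c * f x) = cmod c * L2_norm f"
  by (simp add: L2_norm_def norm_mult power_mult_distrib real_sqrt_mult)

lemma L2_norm_add_le:
  assumes "square_integrable f" "square_integrable g"
  shows "L2_norm (\<lambda>x. f x + g x) \<le> 2 * L2_norm f + 2 * L2_norm g"
proof -
  let ?A = "LINT x|lebesgue. (cmod (f x))\<^sup>2" and ?B = "LINT x|lebesgue. (cmod (g x))\<^sup>2"
  have A: "0 \<le> ?A" and B: "0 \<le> ?B" by auto
  have "(LINT x|lebesgue. (cmod (f x + g x))\<^sup>2)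
      \<le> (LINT x|lebesgue. 2 * (cmod (f x))\<^sup>2 + 2 * (cmod (g x))\<^sup>2)"
    using assms square_integrable_add[OF assms]
    by (intro integral_mono Bochner_Integration.integrable_add integrable_mult_right sq_norm_add_le)
      (simp_all add: square_integrable_def)
  also have "\<dots> = 2 * ?A + 2 * ?B"
    using assms by (simp add: square_integrable_def)
  also have "\<dots> \<le> 4 * ?A + 4 * ?B" using A B by simp
  finally have "L2_norm (\<lambda>x. f x + g x) \<le> sqrt (4 * ?A + 4 * ?B)"
    by (simp add: L2_norm_def)
  also have "\<dots> \<le> sqrt (4 * ?A) + sqrt (4 * ?B)"
    by (rule sqrt_add_le_add_sqrt) (use A B in auto)
  also have "\<dots> = 2 * L2_norm f + 2 * L2_norm g"
    by (simp add: L2_norm_def real_sqrt_mult)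
  finally show ?thesis .
qed

definition L2_rel :: "(real \<Rightarrow> complex) \<Rightarrow> (real \<Rightarrow> complex) \<Rightarrow> bool" where
  "L2_rel f g \<longleftrightarrow> square_integrable f \<and> square_integrable g \<and> (AE x in lebesgue. f x = g x)"

quotient_type L2 = "real \<Rightarrow> complex" / partial: L2_rel
  morphisms rep_L2 abs_L2
proof (rule part_equivpI)
  show "\<exists>f. L2_rel f f"
    using square_integrable_zero by (auto simp: L2_rel_def)
  show "symp L2_rel"
    by (auto simp: symp_def L2_rel_def eq_commute)
  show "transp L2_rel"
  proof (rule transpI)
    fix f g h assume "L2_rel f g" "L2_rel g h"
    then have "square_integrable f" "square_integrable h"
      and fg: "AE x in lebesgue. f x = g x" and gh: "AE x in lebesgue. g x = h x"
      by (auto simp: L2_rel_def)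
    moreover from fg gh have "AE x in lebesgue. f x = h x"
      by eventually_elim simp
    ultimately show "L2_rel f h" by (simp add: L2_rel_def)
  qed
qed

instantiation L2 :: "{zero, minus}"
begin

lift_definition zero_L2 :: L2 is "\<lambda>x. 0"
  by (simp add: L2_rel_def square_integrable_zero)

lift_definition minus_L2 :: "L2 \<Rightarrow> L2 \<Rightarrow> L2" is "\<lambda>f g x. f x - g x"
  by (auto simp: L2_rel_def square_integrable_diff)

instance ..

end

lift_definition scale_L2 :: "complex \<Rightarrow> L2 \<Rightarrow> L2" is "\<lambda>c f x. c * f x"
  by (auto simp: L2_rel_def square_integrable_scale)

text \<open>Multiplication by \<open>a\<close>; only used for \<open>a \<in> L\<^sup>\<infinity>\<close>, the value for other \<open>a\<close> is a dummy.\<close>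

lift_definition mult_L2 :: "(real \<Rightarrow> complex) \<Rightarrow> L2 \<Rightarrow> L2" is
  "\<lambda>a f x. if ess_bounded a then a x * f x else 0"
  subgoal for a f g
    by (cases "ess_bounded a")
       (auto simp: L2_rel_def square_integrable_mult square_integrable_zero)
  done

text \<open>Only used for sequences \<open>\<phi>\<close> of square-integrable functions.\<close>

definition L2_tendsto :: "(nat \<Rightarrow> real \<Rightarrow> complex) \<Rightarrow> L2 \<Rightarrow> bool" where
  "L2_tendsto \<phi> u \<longleftrightarrow> (\<lambda>n. L2_norm (\<lambda>x. \<phi> n x - rep_L2 u x)) \<longlonglongrightarrow> 0"


section \<open>Test functions and weak derivatives\<close>

definition ddx :: "(real \<Rightarrow> complex) \<Rightarrow> real \<Rightarrow> complex" where
  "ddx f = (\<lambda>x. vector_derivative f (at x))"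

definition test_function :: "(real \<Rightarrow> complex) \<Rightarrow> bool" where
  "test_function \<phi> \<longleftrightarrow>
     (\<forall>n x. (ddx ^^ n) \<phi> differentiable (at x)) \<and> compact (closure {x. \<phi> x \<noteq> 0})"

definition weak_derivative :: "L2 \<Rightarrow> L2 \<Rightarrow> bool" where
  "weak_derivative u v \<longleftrightarrow>
     (\<forall>\<phi>. test_function \<phi> \<longrightarrow>
        (LINT x|lebesgue. rep_L2 u x * ddx \<phi> x) = - (LINT x|lebesgue. rep_L2 v x * \<phi> x))"

definition H1 :: "L2 set" where
  "H1 = {u. \<exists>v. weak_derivative u v}"

lemma ddx_zero: "ddx (\<lambda>x. 0) = (\<lambda>x. 0)"
  by (simp add: ddx_def)

lemma ddx_scale:
  "(\<And>x. f differentiable (at x)) \<Longrightarrow> ddx (\<lambda>x. c * f x) = (\<lambda>x. c * ddx f x)"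
  unfolding ddx_def
  by (intro ext vector_derivative_at has_vector_derivative_mult_right)
     (simp add: vector_derivative_works)

lemma ddx_diff:
  "(\<And>x. f differentiable (at x)) \<Longrightarrow> (\<And>x. g differentiable (at x)) \<Longrightarrow>
    ddx (\<lambda>x. f x - g x) = (\<lambda>x. ddx f x - ddx g x)"
  by (simp add: ddx_def)

lemma test_function_differentiable: "test_function \<phi> \<Longrightarrow> \<phi> differentiable (at x)"
  by (auto simp: test_function_def dest: spec[of _ "0::nat"])

lemma test_function_zero: "test_function (\<lambda>x. 0)"
proof -
  have "(ddx ^^ n) (\<lambda>x. 0) = (\<lambda>x. 0)" for n
    by (induction n) (simp_all add: ddx_zero)
  then show ?thesis by (simp add: test_function_def)
qed

lemma test_function_scale:
  assumes "test_function \<phi>"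
  shows "test_function (\<lambda>x. c * \<phi> x)"
proof -
  have diff: "(ddx ^^ n) \<phi> differentiable (at x)" for n x
    using assms by (auto simp: test_function_def)
  have eq: "(ddx ^^ n) (\<lambda>x. c * \<phi> x) = (\<lambda>x. c * (ddx ^^ n) \<phi> x)" for n
    by (induction n) (simp_all add: ddx_scale[OF diff])
  have "compact (closure {x. c * \<phi> x \<noteq> 0})"
  proof (rule compact_closure[THEN iffD2], rule bounded_subset)
    show "bounded {x. \<phi> x \<noteq> 0}"
      using assms by (auto simp: test_function_def)
  qed auto
  then show ?thesis
    unfolding test_function_def eq using diff by (auto intro!: differentiable_mult)
qed

lemma test_function_ddx_continuous:
  assumes "test_function \<phi>"
  shows "continuous_on UNIV (ddx \<phi>)"
proof -
  have "ddx \<phi> differentiable (at x)" for x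
    using assms by (auto simp: test_function_def dest: spec[of _ "1::nat"])
  then show ?thesis
    by (meson continuous_at_imp_continuous_on differentiable_imp_continuous_within)
qed

lemma test_function_ddx_square_integrable:
  assumes "test_function \<phi>"
  shows "square_integrable (ddx \<phi>)"
proof -
  let ?K = "closure {x. \<phi> x \<noteq> 0}"
  have K: "compact ?K" using assms by (simp add: test_function_def)
  have cont: "continuous_on UNIV (ddx \<phi>)" using assms by (rule test_function_ddx_continuous)
  have zero: "ddx \<phi> x = 0" if "x \<notin> ?K" for x
  proof -
    have "(\<phi> has_vector_derivative 0) (at x)"
    proof (rule has_vector_derivative_transform_within_open)
      show "((\<lambda>x. 0) has_vector_derivative 0) (at x)" by simp
      show "open (- ?K)" "x \<in> - ?K" using that by auto
      show "0 = \<phi> y" if "y \<in> - ?K" for y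
        using that closure_subset[of "{x. \<phi> x \<noteq> 0}"] by auto
    qed
    then show ?thesis by (simp add: ddx_def vector_derivative_at)
  qed
  have meas: "ddx \<phi> \<in> borel_measurable lebesgue"
    by (rule measurable_completion) (use borel_measurable_continuous_onI[OF cont] in simp)
  have "continuous_on ?K (\<lambda>x. (cmod (ddx \<phi> x))\<^sup>2)"
    by (rule continuous_on_power[OF continuous_on_norm[OF continuous_on_subset[OF cont subset_UNIV]]])
  then have "set_integrable lborel ?K (\<lambda>x. (cmod (ddx \<phi> x))\<^sup>2)"
    unfolding set_integrable_def by (rule borel_integrable_compact[OF K])
  moreover have "(\<lambda>x. indicator ?K x *\<^sub>R (cmod (ddx \<phi> x))\<^sup>2) = (\<lambda>x. (cmod (ddx \<phi> x))\<^sup>2)"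
    by (rule ext) (metis indicator_simps(1,2) norm_zero power_zero_numeral scaleR_one scaleR_zero_left zero)
  ultimately have "integrable lborel (\<lambda>x. (cmod (ddx \<phi> x))\<^sup>2)"
    unfolding set_integrable_def by simp
  then have "integrable lebesgue (\<lambda>x. (cmod (ddx \<phi> x))\<^sup>2)"
    by (subst integrable_completion)
       (use borel_measurable_continuous_onI[OF cont] in measurable)
  then show ?thesis using meas by (simp add: square_integrable_def)
qed


section \<open>The homogeneous Sobolev space\<close>

definition grad_norm :: "(real \<Rightarrow> complex) \<Rightarrow> real" where
  "grad_norm \<phi> = L2_norm (ddx \<phi>)"

definition grad_Cauchy :: "(nat \<Rightarrow> real \<Rightarrow> complex) \<Rightarrow> bool" where
  "grad_Cauchy \<phi> \<longleftrightarrow> (\<forall>n. test_function (\<phi> n)) \<and>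
     (\<forall>e>0. \<exists>N. \<forall>m\<ge>N. \<forall>n\<ge>N. grad_norm (\<lambda>x. \<phi> m x - \<phi> n x) < e)"

definition Hdot1_rel ::
  "(nat \<Rightarrow> real \<Rightarrow> complex) \<Rightarrow> (nat \<Rightarrow> real \<Rightarrow> complex) \<Rightarrow> bool" where
  "Hdot1_rel \<phi> \<psi> \<longleftrightarrow> grad_Cauchy \<phi> \<and> grad_Cauchy \<psi> \<and>
     (\<lambda>n. grad_norm (\<lambda>x. \<phi> n x - \<psi> n x)) \<longlonglongrightarrow> 0"

lemma grad_norm_diff:
  "test_function \<phi> \<Longrightarrow> test_function \<psi> \<Longrightarrow>
    grad_norm (\<lambda>x. \<phi> x - \<psi> x) = L2_norm (\<lambda>x. ddx \<phi> x - ddx \<psi> x)"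
  by (simp add: grad_norm_def ddx_diff test_function_differentiable)

lemma grad_norm_diff_commute:
  "test_function \<phi> \<Longrightarrow> test_function \<psi> \<Longrightarrow>
    grad_norm (\<lambda>x. \<phi> x - \<psi> x) = grad_norm (\<lambda>x. \<psi> x - \<phi> x)"
  by (simp only: grad_norm_diff L2_norm_minus_commute[of "ddx \<phi>"])

lemma grad_norm_diff_scale:
  "test_function \<phi> \<Longrightarrow> test_function \<psi> \<Longrightarrow>
    grad_norm (\<lambda>x. c * \<phi> x - c * \<psi> x) = cmod c * grad_norm (\<lambda>x. \<phi> x - \<psi> x)"
  using L2_norm_scale[of c "\<lambda>x. ddx \<phi> x - ddx \<psi> x"]
  by (simp add: grad_norm_diff test_function_scale ddx_scale test_function_differentiable
      right_diff_distrib)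

lemma grad_norm_diff_triangle:
  assumes "test_function \<phi>" "test_function \<psi>" "test_function \<eta>"
  shows "grad_norm (\<lambda>x. \<phi> x - \<eta> x)
      \<le> 2 * grad_norm (\<lambda>x. \<phi> x - \<psi> x) + 2 * grad_norm (\<lambda>x. \<psi> x - \<eta> x)"
  using L2_norm_add_le[of "\<lambda>x. ddx \<phi> x - ddx \<psi> x" "\<lambda>x. ddx \<psi> x - ddx \<eta> x"] assms
  by (simp add: grad_norm_diff square_integrable_diff test_function_ddx_square_integrable)

lemma grad_norm_zero: "grad_norm (\<lambda>x. 0) = 0"
  by (simp add: grad_norm_def ddx_zero L2_norm_def)

lemma grad_Cauchy_zero: "grad_Cauchy (\<lambda>n x. 0)"
  by (simp add: grad_Cauchy_def test_function_zero grad_norm_zero)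

lemma grad_Cauchy_scale:
  assumes "grad_Cauchy \<phi>"
  shows "grad_Cauchy (\<lambda>n x. c * \<phi> n x)"
  unfolding grad_Cauchy_def
proof (intro conjI allI impI)
  have test: "test_function (\<phi> n)" for n using assms by (simp add: grad_Cauchy_def)
  show "test_function (\<lambda>x. c * \<phi> n x)" for n by (rule test_function_scale[OF test])
  fix e :: real assume e: "e > 0"
  then have "e / (cmod c + 1) > 0" by (simp add: add_nonneg_pos)
  moreover have "\<forall>e>0. \<exists>N. \<forall>m\<ge>N. \<forall>n\<ge>N. grad_norm (\<lambda>x. \<phi> m x - \<phi> n x) < e"
    using assms unfolding grad_Cauchy_def by (rule conjunct2)
  ultimately obtain N where
    N: "\<forall>m\<ge>N. \<forall>n\<ge>N. grad_norm (\<lambda>x. \<phi> m x - \<phi> n x) < e / (cmod c + 1)"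
    by blast
  have "cmod c * grad_norm (\<lambda>x. \<phi> m x - \<phi> n x) < e" if "m \<ge> N" "n \<ge> N" for m n
  proof -
    have le: "grad_norm (\<lambda>x. \<phi> m x - \<phi> n x) \<le> e / (cmod c + 1)"
      using N that less_imp_le by blast
    have "cmod c * grad_norm (\<lambda>x. \<phi> m x - \<phi> n x) \<le> cmod c * (e / (cmod c + 1))"
      by (rule mult_left_mono[OF le norm_ge_zero])
    also have "\<dots> = cmod c * e / (cmod c + 1)" by simp
    also have "\<dots> < e"
      using e norm_ge_zero[of c] by (subst pos_divide_less_eq) (linarith, simp add: distrib_left)
    finally show ?thesis .
  qed
  then show "\<exists>N. \<forall>m\<ge>N. \<forall>n\<ge>N. grad_norm (\<lambda>x. c * \<phi> m x - c * \<phi> n x) < e"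
    unfolding grad_norm_diff_scale[OF test test] by blast
qed

text \<open>The completion of the test functions under \<^term>\<open>grad_norm\<close>: Cauchy sequences modulo
  sequences tending to zero.\<close>

quotient_type Hdot1 = "nat \<Rightarrow> real \<Rightarrow> complex" / partial: Hdot1_rel
  morphisms rep_Hdot1 abs_Hdot1
proof (rule part_equivpI)
  show "\<exists>\<phi>. Hdot1_rel \<phi> \<phi>"
    using grad_Cauchy_zero by (auto simp: Hdot1_rel_def grad_norm_zero)
  show "symp Hdot1_rel"
  proof (rule sympI)
    fix \<phi> \<psi> assume *: "Hdot1_rel \<phi> \<psi>"
    then have "(\<lambda>n. grad_norm (\<lambda>x. \<psi> n x - \<phi> n x)) = (\<lambda>n. grad_norm (\<lambda>x. \<phi> n x - \<psi> n x))"
      by (intro ext grad_norm_diff_commute) (auto simp: Hdot1_rel_def grad_Cauchy_def)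
    with * show "Hdot1_rel \<psi> \<phi>" by (simp add: Hdot1_rel_def)
  qed
  show "transp Hdot1_rel"
  proof (rule transpI)
    fix \<phi> \<psi> \<eta> assume *: "Hdot1_rel \<phi> \<psi>" "Hdot1_rel \<psi> \<eta>"
    then have test: "test_function (\<phi> n)" "test_function (\<psi> n)" "test_function (\<eta> n)" for n
      by (auto simp: Hdot1_rel_def grad_Cauchy_def)
    have "(\<lambda>n. grad_norm (\<lambda>x. \<phi> n x - \<eta> n x)) \<longlonglongrightarrow> 0"
    proof (rule tendsto_sandwich[OF _ _ tendsto_const])
      show "\<forall>\<^sub>F n in sequentially. grad_norm (\<lambda>x. \<phi> n x - \<eta> n x)
          \<le> 2 * grad_norm (\<lambda>x. \<phi> n x - \<psi> n x) + 2 * grad_norm (\<lambda>x. \<psi> n x - \<eta> n x)"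
        by (intro always_eventually allI grad_norm_diff_triangle test)
      have "(\<lambda>n. 2 * grad_norm (\<lambda>x. \<phi> n x - \<psi> n x) + 2 * grad_norm (\<lambda>x. \<psi> n x - \<eta> n x))
          \<longlonglongrightarrow> 2 * 0 + 2 * 0"
        by (intro tendsto_intros) (use * in \<open>auto simp: Hdot1_rel_def\<close>)
      then show "(\<lambda>n. 2 * grad_norm (\<lambda>x. \<phi> n x - \<psi> n x)
          + 2 * grad_norm (\<lambda>x. \<psi> n x - \<eta> n x)) \<longlonglongrightarrow> 0" by simp
    qed (simp add: grad_norm_def L2_norm_nonneg)
    with * show "Hdot1_rel \<phi> \<eta>" by (simp add: Hdot1_rel_def)
  qed
qed

instantiation Hdot1 :: zero
begin

lift_definition zero_Hdot1 :: Hdot1 is "\<lambda>n x. 0"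
  by (simp add: Hdot1_rel_def grad_Cauchy_zero grad_norm_zero)

instance ..

end

lift_definition scale_Hdot1 :: "complex \<Rightarrow> Hdot1 \<Rightarrow> Hdot1" is "\<lambda>c \<phi> n x. c * \<phi> n x"
proof -
  fix c :: complex and \<phi> \<psi> assume *: "Hdot1_rel \<phi> \<psi>"
  then have test: "test_function (\<phi> n)" "test_function (\<psi> n)" for n
    by (auto simp: Hdot1_rel_def grad_Cauchy_def)
  have "(\<lambda>n. cmod c * grad_norm (\<lambda>x. \<phi> n x - \<psi> n x)) \<longlonglongrightarrow> cmod c * 0"
    by (intro tendsto_intros) (use * in \<open>auto simp: Hdot1_rel_def\<close>)
  with * show "Hdot1_rel (\<lambda>n x. c * \<phi> n x) (\<lambda>n x. c * \<psi> n x)"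
    by (simp add: Hdot1_rel_def grad_Cauchy_scale grad_norm_diff_scale[OF test])
qed

definition gradient :: "Hdot1 \<Rightarrow> L2 \<Rightarrow> bool" where
  "gradient \<psi> g \<longleftrightarrow>
     (\<exists>\<phi>. grad_Cauchy \<phi> \<and> \<psi> = abs_Hdot1 \<phi> \<and> L2_tendsto (\<lambda>n. ddx (\<phi> n)) g)"

definition laplacian :: "Hdot1 \<Rightarrow> L2 \<Rightarrow> bool" where
  "laplacian \<psi> h \<longleftrightarrow> (\<exists>g. gradient \<psi> g \<and> weak_derivative g h)"

text \<open>The graph of the natural inclusion of \<open>H\<^sup>1\<close>: test functions approximating \<open>u\<close> in
  \<open>H\<^sup>1\<close> represent its image.\<close>

definition H1_inclusion :: "L2 \<Rightarrow> Hdot1 \<Rightarrow> bool" where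
  "H1_inclusion u \<psi> \<longleftrightarrow>
     (\<exists>\<phi> v. grad_Cauchy \<phi> \<and> \<psi> = abs_Hdot1 \<phi> \<and> weak_derivative u v \<and>
        L2_tendsto \<phi> u \<and> L2_tendsto (\<lambda>n. ddx (\<phi> n)) v)"


section \<open>The damped wave operator\<close>

type_synonym energy_space = "Hdot1 \<times> L2"

fun scale_energy :: "complex \<Rightarrow> energy_space \<Rightarrow> energy_space" where
  "scale_energy c (\<psi>\<^sub>1, \<psi>\<^sub>2) = (scale_Hdot1 c \<psi>\<^sub>1, scale_L2 c \<psi>\<^sub>2)"

text \<open>Operators are given by their graphs. In the first component of the value, \<open>\<eta>\<close> is
  \<open>\<psi>\<^sub>2\<close> regarded as an element of \<^typ>\<open>Hdot1\<close>.\<close>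

definition damped_wave_operator ::
  "(real \<Rightarrow> complex) \<Rightarrow> (energy_space \<times> energy_space) set" where
  "damped_wave_operator a =
     {((\<psi>\<^sub>1, \<psi>\<^sub>2), (\<eta>, h - mult_L2 a \<psi>\<^sub>2)) | \<psi>\<^sub>1 \<psi>\<^sub>2 \<eta> h.
        laplacian \<psi>\<^sub>1 h \<and> \<psi>\<^sub>2 \<in> H1 \<and> H1_inclusion \<psi>\<^sub>2 \<eta>}"

definition point_spectrum :: "(energy_space \<times> energy_space) set \<Rightarrow> complex set" where
  "point_spectrum A = {\<mu>. \<exists>\<Psi>. \<Psi> \<noteq> 0 \<and> (\<Psi>, scale_energy \<mu> \<Psi>) \<in> A}"

end

theory Submission
  imports Defs
begin

text \<open>
  Let \<open>\<mu>\<close> be an eigenvalue with eigenvector \<open>(\<psi>, u)\<close> and put \<open>g = \<psi>'\<close>. Both \<open>u\<close> and \<open>g\<close> lie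
  in \<open>L\<^sup>2\<close>, and weakly \<open>u' = \<mu> g\<close> and \<open>g' = (\<mu> + a) u\<close>. The combinations \<open>p = g + u\<close> and
  \<open>q = g - u\<close> diagonalise the principal part: \<open>p' = \<mu> p + a u\<close> and \<open>q' = -\<mu> q + a u\<close>. If
  \<open>Re \<mu> \<ge> 0\<close>, integrating the first equation from \<open>+\<infinity>\<close> and the second from \<open>-\<infinity>\<close> gives
  \<open>\<bar>p(x)\<bar> \<le> \<integral>\<^sub>x\<^sup>\<infinity> \<bar>a u\<bar>\<close> and \<open>\<bar>q(x)\<bar> \<le> \<integral>\<^sub>-\<^sub>\<infinity>\<^sup>x \<bar>a u\<bar>\<close>; if \<open>Re \<mu> \<le> 0\<close>, the two
  directions are exchanged. In both cases \<open>2 \<bar>u\<bar> \<le> \<bar>p\<bar> + \<bar>q\<bar> \<le> I\<close> and likewise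
  \<open>2 \<bar>g\<bar> \<le> I\<close>, where \<open>I = \<integral> \<bar>a u\<bar>\<close>. Hence \<open>I \<le> \<parallel>a\<parallel>\<^sub>1 I / 2\<close>, so that \<open>\<parallel>a\<parallel>\<^sub>1 < 2\<close>
  forces \<open>I = 0\<close>, and then \<open>u = g = 0\<close> and \<open>\<psi> = 0\<close>. The case \<open>\<mu> = 0\<close> needs no separate
  treatment. This is \<open>first_order_system_trivial\<close>.

  The half-line bound \<open>weak_ode_bound\<close> is proved directly from the weak formulation, without
  absolutely continuous representatives. The equation is tested with \<open>exp (- \<mu> x) W(x)\<close>, where
  \<open>W\<close> is a smoothed trapezoid that rises on \<open>[s, s + h]\<close> and falls on \<open>[s + R, s + R + h]\<close>. The
  smoothing is removed by dominated convergence; letting \<open>R \<rightarrow> \<plusminus>\<infinity>\<close> removes the contribution of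
  the far edge, because \<open>p\<close> is square-integrable; and \<open>h \<rightarrow> 0\<close> recovers \<open>p(s)\<close> for almost
  every \<open>s\<close> by Lebesgue's differentiation theorem.

  For the optimality of the constant, the function \<open>u(x) = cosh(x)\<^sup>-\<^sup>m\<close> with \<open>m > 0\<close> satisfies
  \<open>u'' = m\<^sup>2 u + m a u\<close> for \<open>a = - (1 + m) (1 - tanh\<^sup>2)\<close>. Thus \<open>m\<close> is an eigenvalue with
  eigenvector \<open>(u, m u)\<close>, and \<open>\<parallel>a\<parallel>\<^sub>1 = 2 (1 + m)\<close> exceeds \<open>2\<close> by as little as desired
  (\<open>sech_damping_eigenvalue\<close>). To see \<open>u\<close> as an element of the completion it is approximated by
  test functions, obtained from smooth cut-offs.
\<close>

section \<open>Smooth functions\<close>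

text \<open>Infinite differentiability, phrased through iterated derivatives as in
  \<^const>\<open>test_function\<close>.\<close>

definition smooth :: "(real \<Rightarrow> complex) \<Rightarrow> bool" where
  "smooth f \<longleftrightarrow> (\<forall>n x. (ddx ^^ n) f differentiable (at x))"

lemma test_function_iff: "test_function \<phi> \<longleftrightarrow> smooth \<phi> \<and> compact (closure {x. \<phi> x \<noteq> 0})"
  by (simp add: test_function_def smooth_def)

lemma smooth_differentiable: "smooth f \<Longrightarrow> f differentiable (at x)"
  unfolding smooth_def by (metis funpow_0)

lemma smooth_ddx: "smooth f \<Longrightarrow> smooth (ddx f)"
  unfolding smooth_def by (metis comp_apply funpow_Suc_right)

lemma smooth_has_vector_derivative: "smooth f \<Longrightarrow> (f has_vector_derivative ddx f x) (at x)"
  using smooth_differentiable vector_derivative_works unfolding ddx_def by blast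

lemma smooth_continuous: "smooth f \<Longrightarrow> continuous_on S f"
  by (meson continuous_at_imp_continuous_on differentiable_imp_continuous_within smooth_differentiable)

lemma ddx_eqI: "(\<And>x. (f has_vector_derivative f' x) (at x)) \<Longrightarrow> ddx f = f'"
  unfolding ddx_def by (auto intro: vector_derivative_at)

text \<open>A function is smooth if it belongs to a set of differentiable functions that is closed under
  differentiation. The basic smoothness proofs below exhibit such a set.\<close>

lemma smooth_coinduct:
  assumes "f \<in> S"
    and "\<And>f. f \<in> S \<Longrightarrow> \<exists>f'\<in>S. \<forall>x. (f has_vector_derivative f' x) (at x)"
  shows "smooth f"
proof -
  have step: "ddx f \<in> S \<and> (\<forall>x. f differentiable (at x))" if f: "f \<in> S" for f
  proof -
    obtain f' where f': "f' \<in> S" "\<And>x. (f has_vector_derivative f' x) (at x)"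
      using assms(2)[OF f] by blast
    moreover from f'(2) have "ddx f = f'" by (rule ddx_eqI)
    ultimately show ?thesis by (auto intro: differentiableI_vector)
  qed
  have "(ddx ^^ n) f \<in> S" for n
    by (induction n) (use assms(1) step in auto)
  with step show ?thesis by (auto simp: smooth_def)
qed

lemma smooth_primitive:
  assumes "\<And>x. (f has_vector_derivative f' x) (at x)" "smooth f'"
  shows "smooth f"
proof (rule smooth_coinduct[of _ "insert f (Collect smooth)"])
  fix g assume "g \<in> insert f (Collect smooth)"
  then show "\<exists>g'\<in>insert f (Collect smooth). \<forall>x. (g has_vector_derivative g' x) (at x)"
    using assms smooth_ddx smooth_has_vector_derivative by blast
qed simp

lemma smooth_add:
  assumes "smooth f" "smooth g" shows "smooth (\<lambda>x. f x + g x)"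
proof (rule smooth_coinduct[of _ "{\<lambda>x. f x + g x |f g. smooth f \<and> smooth g}"])
  fix h assume "h \<in> {\<lambda>x. f x + g x |f g. smooth f \<and> smooth g}"
  then obtain f g where h: "h = (\<lambda>x. f x + g x)" "smooth f" "smooth g" by blast
  show "\<exists>h'\<in>{\<lambda>x. f x + g x |f g. smooth f \<and> smooth g}. \<forall>x. (h has_vector_derivative h' x) (at x)"
  proof
    show "\<forall>x. (h has_vector_derivative (ddx f x + ddx g x)) (at x)"
      unfolding h(1) using h(2,3) by (auto intro!: derivative_intros smooth_has_vector_derivative)
  qed (use h smooth_ddx in blast)
qed (use assms in blast)

text \<open>Finite sums of products of smooth functions. A single product does not suffice, since its
  derivative is already a sum of two products.\<close>

inductive_set sums_of_products :: "(real \<Rightarrow> complex) set" where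
  prod: "smooth f \<Longrightarrow> smooth g \<Longrightarrow> (\<lambda>x. f x * g x) \<in> sums_of_products"
| sum: "f \<in> sums_of_products \<Longrightarrow> g \<in> sums_of_products \<Longrightarrow> (\<lambda>x. f x + g x) \<in> sums_of_products"

lemma has_vector_derivative_mult_smooth:
  assumes "smooth f" "smooth g"
  shows "((\<lambda>x. f x * g x) has_vector_derivative f x * ddx g x + ddx f x * g x) (at x)"
  by (intro has_vector_derivative_mult smooth_has_vector_derivative assms)

lemma ddx_mult:
  "smooth f \<Longrightarrow> smooth g \<Longrightarrow> ddx (\<lambda>x. f x * g x) = (\<lambda>x. f x * ddx g x + ddx f x * g x)"
  by (intro ddx_eqI has_vector_derivative_mult_smooth)

lemma smooth_mult:
  assumes "smooth f" "smooth g" shows "smooth (\<lambda>x. f x * g x)"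
proof (rule smooth_coinduct[of _ sums_of_products])
  fix h assume "h \<in> sums_of_products"
  then show "\<exists>h'\<in>sums_of_products. \<forall>x. (h has_vector_derivative h' x) (at x)"
  proof induction
    case (prod f g)
    then have "(\<lambda>x. f x * ddx g x + ddx f x * g x) \<in> sums_of_products"
      by (intro sums_of_products.intros smooth_ddx)
    then show ?case
      by (rule bexI[rotated]) (intro allI has_vector_derivative_mult_smooth prod)
  next
    case (sum f g)
    then obtain f' g' where "f' \<in> sums_of_products" "g' \<in> sums_of_products"
      "\<And>x. (f has_vector_derivative f' x) (at x)" "\<And>x. (g has_vector_derivative g' x) (at x)"
      by blast
    then show ?case
      by (intro bexI[of _ "\<lambda>x. f' x + g' x"] allI has_vector_derivative_add
          sums_of_products.intros)
  qed
qed (intro sums_of_products.intros assms)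

lemma smooth_exp: "smooth (\<lambda>x. c * exp (\<mu> * of_real x))"
proof (rule smooth_coinduct[of _ "range (\<lambda>c x. c * exp (\<mu> * of_real x))"])
  fix f assume "f \<in> range (\<lambda>c x. c * exp (\<mu> * complex_of_real x))"
  then obtain c where f: "f = (\<lambda>x. c * exp (\<mu> * of_real x))" by blast
  show "\<exists>f'\<in>range (\<lambda>c x. c * exp (\<mu> * complex_of_real x)).
      \<forall>x. (f has_vector_derivative f' x) (at x)"
  proof
    show "\<forall>x. (f has_vector_derivative (c * \<mu>) * exp (\<mu> * of_real x)) (at x)"
    proof
      fix x
      have "((\<lambda>z. c * exp (\<mu> * z)) has_field_derivative (c * \<mu>) * exp (\<mu> * of_real x)) (at (of_real x))"
        by (auto intro!: derivative_eq_intros)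
      then show "(f has_vector_derivative (c * \<mu>) * exp (\<mu> * of_real x)) (at x)"
        unfolding f by (rule has_vector_derivative_real_field)
    qed
  qed blast
qed blast

lemma smooth_const: "smooth (\<lambda>x. c)"
  using smooth_exp[of c 0] by simp

lemma smooth_cmult: "smooth f \<Longrightarrow> smooth (\<lambda>x. c * f x)"
  by (rule smooth_mult[OF smooth_const])

lemma smooth_diff: "smooth f \<Longrightarrow> smooth g \<Longrightarrow> smooth (\<lambda>x. f x - g x)"
  using smooth_add[OF _ smooth_cmult, of f g "-1"] by simp

lemma smooth_affine:
  assumes "smooth f" shows "smooth (\<lambda>x. f (m * x + b))"
proof (rule smooth_coinduct[of _ "{\<lambda>x. c * f (m * x + b) |c f. smooth f}"])
  show "(\<lambda>x. f (m * x + b)) \<in> {\<lambda>x. c * f (m * x + b) |c f. smooth f}"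
    using assms by (auto intro!: exI[of _ 1])
  fix h assume "h \<in> {\<lambda>x. c * f (m * x + b) |c f. smooth f}"
  then obtain c f where h: "h = (\<lambda>x. c * f (m * x + b))" "smooth f" by blast
  show "\<exists>h'\<in>{\<lambda>x. c * f (m * x + b) |c f. smooth f}. \<forall>x. (h has_vector_derivative h' x) (at x)"
  proof
    show "\<forall>x. (h has_vector_derivative (c * of_real m) * ddx f (m * x + b)) (at x)"
    proof
      fix x
      have "((\<lambda>x. m * x + b) has_vector_derivative m) (at x)"
        by (auto intro!: derivative_eq_intros)
      from vector_diff_chain_at[OF this smooth_has_vector_derivative[OF h(2)]]
      have "((\<lambda>x. f (m * x + b)) has_vector_derivative m *\<^sub>R ddx f (m * x + b)) (at x)"
        by (simp add: o_def)
      from has_vector_derivative_mult_right[OF this, of c]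
      show "(h has_vector_derivative (c * of_real m) * ddx f (m * x + b)) (at x)"
        by (simp add: h(1) scaleR_conv_of_real mult.assoc)
    qed
  qed (use h(2) smooth_ddx in blast)
qed

lemma has_vector_derivative_of_real_comp:
  fixes f :: "real \<Rightarrow> real"
  assumes "(f has_real_derivative D) (at x)"
  shows "((\<lambda>x. complex_of_real (f x)) has_vector_derivative of_real D) (at x)"
  using assms by (intro has_vector_derivative_of_real)

subsection \<open>A smooth step\<close>

text \<open>The functions \<open>p(1/x) exp(-1/x)\<close> with a polynomial \<open>p\<close>, extended by zero to the left half-line.
  Their derivatives have the same form.\<close>

definition flat :: "real poly \<Rightarrow> real \<Rightarrow> real" where
  "flat p x = (if x \<le> 0 then 0 else poly p (1 / x) * exp (- (1 / x)))"

lemma poly_times_exp_minus_tendsto_0: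
  fixes p :: "real poly" shows "((\<lambda>y. poly p y * exp (- y)) \<longlongrightarrow> 0) at_top"
proof -
  have "((\<lambda>y. \<Sum>i\<le>degree p. coeff p i * (y ^ i / exp y)) \<longlongrightarrow> (\<Sum>i\<le>degree p. coeff p i * 0)) at_top"
    by (intro tendsto_intros tendsto_power_div_exp_0)
  then show ?thesis
    by (simp add: poly_altdef sum_distrib_right exp_minus divide_inverse mult.assoc)
qed

lemma flat_has_derivative:
  "(flat p has_real_derivative flat ([:0, 0, 1:] * (p - pderiv p)) x) (at x)"
proof -
  let ?q = "[:0, 0, 1:] * (p - pderiv p)"
  consider "x < 0" | "x > 0" | "x = 0" by linarith
  then show ?thesis
  proof cases
    case 1
    show ?thesis
    proof (rule has_field_derivative_transform_within_open[of "\<lambda>_. 0" _ _ "{..<0}"])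
      show "((\<lambda>_. 0) has_real_derivative flat ?q x) (at x)" using 1 by (simp add: flat_def)
    qed (use 1 in \<open>auto simp: flat_def\<close>)
  next
    case 2
    show ?thesis
    proof (rule has_field_derivative_transform_within_open
        [of "\<lambda>x. poly p (1 / x) * exp (- (1 / x))" _ _ "{0<..}"])
      show "((\<lambda>x. poly p (1 / x) * exp (- (1 / x))) has_real_derivative flat ?q x) (at x)"
        using 2 by (auto intro!: derivative_eq_intros DERIV_chain'[OF _ poly_DERIV]
            simp: flat_def field_simps power2_eq_square)
    qed (use 2 in \<open>auto simp: flat_def\<close>)
  next
    case 3
    have "((\<lambda>y. flat p y / y) \<longlongrightarrow> 0) (at_right 0)"
    proof (rule Lim_transform_eventually)
      have "filterlim (\<lambda>y::real. 1 / y) at_top (at_right 0)"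
        using filterlim_inverse_at_top_right by (simp add: inverse_eq_divide)
      from filterlim_compose[OF poly_times_exp_minus_tendsto_0[of "pCons 0 p"] this]
      show "((\<lambda>y. poly (pCons 0 p) (1 / y) * exp (- (1 / y))) \<longlongrightarrow> 0) (at_right 0)" .
      show "\<forall>\<^sub>F y in at_right 0. poly (pCons 0 p) (1 / y) * exp (- (1 / y)) = flat p y / y"
        by (auto simp: eventually_at_right_field flat_def intro!: exI[of _ 1])
    qed
    moreover have "((\<lambda>y. flat p y / y) \<longlongrightarrow> 0) (at_left 0)"
      by (rule tendsto_eventually)
         (auto simp: eventually_at_left_field flat_def intro!: exI[of _ "-1"])
    ultimately have "((\<lambda>y. flat p y / y) \<longlongrightarrow> 0) (at 0)"
      by (simp add: filterlim_split_at)
    then show ?thesis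
      using 3 by (simp add: has_field_derivative_iff flat_def)
  qed
qed

lemma smooth_flat: "smooth (\<lambda>x. of_real (flat p x))"
proof (rule smooth_coinduct[of _ "range (\<lambda>p x. of_real (flat p x))"])
  fix f assume "f \<in> range (\<lambda>p x. complex_of_real (flat p x))"
  then show "\<exists>f'\<in>range (\<lambda>p x. complex_of_real (flat p x)). \<forall>x. (f has_vector_derivative f' x) (at x)"
    by (auto intro!: has_vector_derivative_of_real_comp flat_has_derivative)
qed blast

lemma continuous_has_primitive:
  fixes f :: "real \<Rightarrow> real"
  assumes "continuous_on UNIV f"
  obtains F where "\<And>x. (F has_real_derivative f x) (at x)"
proof
  fix x :: real
  let ?r = "\<bar>x\<bar> + 1"
  have "((\<lambda>u. LBINT y=0..u. f y) has_vector_derivative f x) (at x within {-?r..?r})"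
    unfolding zero_ereal_def
    by (rule interval_integral_FTC2)
       (use assms continuous_on_subset in auto)
  moreover have "at x within {-?r..?r} = at x"
    by (rule at_within_interior) (auto simp: abs_if)
  ultimately show "((\<lambda>u. LBINT y=0..u. f y) has_real_derivative f x) (at x)"
    by (simp add: has_real_derivative_iff_has_vector_derivative)
qed

lemma smooth_step_exists:
  obtains J J' :: "real \<Rightarrow> real" and C
  where "\<And>x. (J has_real_derivative J' x) (at x)" "smooth (\<lambda>x. of_real (J x))"
    "\<And>x. x \<le> 0 \<Longrightarrow> J x = 0" "\<And>x. x \<ge> 1 \<Longrightarrow> J x = 1"
    "\<And>x. 0 \<le> J x" "\<And>x. J x \<le> 1"
    "\<And>x. 0 \<le> J' x" "\<And>x. J' x \<le> C" "\<And>x. x \<le> 0 \<or> x \<ge> 1 \<Longrightarrow> J' x = 0"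
proof -
  \<comment> \<open>The step is the normalised primitive of a bump supported in the unit interval.\<close>
  define b where "b x = flat 1 x * flat 1 (1 - x)" for x
  have smooth_b: "smooth (\<lambda>x. of_real (b x))"
    using smooth_mult[OF smooth_flat[of 1] smooth_affine[OF smooth_flat[of 1], of "-1" 1]]
    by (simp add: b_def)
  have cont_flat: "continuous_on S (flat p)" for S p
    by (meson DERIV_isCont continuous_at_imp_continuous_on flat_has_derivative)
  have cont_b: "continuous_on S b" for S
    unfolding b_def by (intro continuous_intros cont_flat continuous_on_compose2[OF cont_flat[of UNIV]]) auto
  have b_nonneg: "0 \<le> b x" and b_le: "b x \<le> 1" for x
    by (auto simp: b_def flat_def mult_le_one)
  have b_pos: "0 < b x" if "0 < x" "x < 1" for x
    using that by (simp add: b_def flat_def)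
  have b_zero: "b x = 0" if "x \<le> 0 \<or> x \<ge> 1" for x
    using that by (auto simp: b_def flat_def)
  obtain G where G: "\<And>x. (G has_real_derivative b x) (at x)"
    using continuous_has_primitive[OF cont_b] by blast
  have cont_G: "continuous_on S G" for S
    by (intro continuous_at_imp_continuous_on ballI DERIV_isCont[OF G])
  have G01: "G 0 < G 1"
  proof (rule DERIV_pos_imp_increasing_open[where f = G])
    show "\<exists>y. (G has_real_derivative y) (at x) \<and> y > 0" if "0 < x" "x < 1" for x
      using G b_pos[OF that] by blast
    show "continuous_on {0..1} G"
by (rule cont_G)
  qed simp
  have G_left: "G x = G 0" if "x \<le> 0" for x
  proof (cases "x = 0")
    case False
    with that have "x < 0" by simp
    moreover have "(G has_real_derivative 0) (at y)" if "y < 0" for y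
      using G[of y] b_zero[of y] that by simp
    ultimately show ?thesis
      using DERIV_isconst_end[of x 0 G] cont_G by simp
  qed simp
  have G_right: "G x = G 1" if "x \<ge> 1" for x
  proof (cases "x = 1")
    case False
    with that have "1 < x" by simp
    moreover have "(G has_real_derivative 0) (at y)" if "1 < y" for y
      using G[of y] b_zero[of y] that by simp
    ultimately show ?thesis
      using DERIV_isconst_end[of 1 x G] cont_G by simp
  qed simp
  define J where "J x = (G x - G 0) / (G 1 - G 0)" for x
  define J' where "J' x = b x / (G 1 - G 0)" for x
  have J: "(J has_real_derivative J' x) (at x)" for x
    unfolding J_def J'_def using G01 by (auto intro!: derivative_eq_intros G)
  have "smooth (\<lambda>x. of_real (J' x))"
    using smooth_cmult[OF smooth_b, of "inverse (of_real (G 1 - G 0))"]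
    by (simp add: J'_def field_simps)
  then have sJ: "smooth (\<lambda>x. of_real (J x))"
    by (rule smooth_primitive[OF has_vector_derivative_of_real_comp[OF J]])
  show ?thesis
  proof (rule that[OF J sJ])
    show J0: "J x = 0" if "x \<le> 0" for x
      using G_left[OF that] by (simp add: J_def)
    show J1: "J x = 1" if "x \<ge> 1" for x
      using G_right[OF that] G01 by (simp add: J_def)
    show J'0: "0 \<le> J' x" "J' x \<le> 1 / (G 1 - G 0)" for x
      using b_nonneg[of x] b_le[of x] G01 by (simp_all add: J'_def divide_right_mono)
    show "J' x = 0" if "x \<le> 0 \<or> x \<ge> 1" for x
      using b_zero[OF that] by (simp add: J'_def)
    have mono: "J x \<le> J y" if "x \<le> y" for x y
      using DERIV_nonneg_imp_nondecreasing[of x y J] that J J'0(1) by blast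
    show "0 \<le> J x" for x
      using mono[of 0 x] J0[of x] J0[of 0] by (cases "x \<le> 0") auto
    show "J x \<le> 1" for x
      using mono[of x 1] J1[of x] J1[of 1] by (cases "x \<ge> 1") auto
  qed
qed

section \<open>Square-integrable functions and test functions\<close>

lemma continuous_borel_measurable_lebesgue:
  fixes f :: "real \<Rightarrow> 'a::topological_space"
  assumes "continuous_on UNIV f" shows "f \<in> borel_measurable lebesgue"
  by (rule measurable_completion) (use borel_measurable_continuous_onI[OF assms] in simp)

lemma smooth_measurable: "smooth f \<Longrightarrow> f \<in> borel_measurable lebesgue"
  by (intro continuous_borel_measurable_lebesgue smooth_continuous)

lemma integrable_indicator_Icc: "integrable lebesgue (indicator {A..B::real} :: real \<Rightarrow> real)"
  by (rule integrable_real_indicator) (auto simp: emeasure_lborel_Icc_eq)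

lemma square_integrable_integrable_Icc:
  assumes "square_integrable f"
  shows "integrable lebesgue (\<lambda>x. indicator {A..B} x * cmod (f x))"
proof (rule Bochner_Integration.integrable_bound)
  have f: "f \<in> borel_measurable lebesgue"
    using assms by (simp add: square_integrable_def)
  show "integrable lebesgue (\<lambda>x. indicator {A..B} x + (cmod (f x))\<^sup>2)"
    using assms integrable_indicator_Icc by (auto simp: square_integrable_def)
  show "(\<lambda>x. indicator {A..B} x * cmod (f x)) \<in> borel_measurable lebesgue"
    by (intro borel_measurable_times borel_measurable_indicator measurable_compose[OF f borel_measurable_norm]) simp
  have "t \<le> 1 + t\<^sup>2" for t :: real
    using sum_power2_ge_zero[of "t - 1/2" 0] by (simp add: power2_eq_square algebra_simps)
  then show "AE x in lebesgue. norm (indicator {A..B} x * cmod (f x))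
      \<le> norm (indicator {A..B} x + (cmod (f x))\<^sup>2)"
    by (auto simp: indicator_def)
qed

lemma square_integrable_integrable_mult:
  assumes "square_integrable f" "c \<in> borel_measurable lebesgue"
    and "\<And>x. cmod (c x) \<le> C * indicator {A..B} x"
  shows "integrable lebesgue (\<lambda>x. f x * c x)"
proof (rule Bochner_Integration.integrable_bound)
  have [measurable]: "f \<in> borel_measurable lebesgue" "c \<in> borel_measurable lebesgue"
    using assms by (auto simp: square_integrable_def)
  show "integrable lebesgue (\<lambda>x. C * (indicator {A..B} x * cmod (f x)))"
    by (intro integrable_mult_right square_integrable_integrable_Icc assms)
  show "(\<lambda>x. f x * c x) \<in> borel_measurable lebesgue"
    by measurable
  have "cmod (f x) * cmod (c x) \<le> cmod (f x) * \<bar>C * indicator {A..B} x\<bar>" for x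
    using assms(3)[of x] by (intro mult_left_mono) auto
  then show "AE x in lebesgue. norm (f x * c x) \<le> norm (C * (indicator {A..B} x * cmod (f x)))"
    by (auto simp: norm_mult abs_mult mult_ac)
qed

lemma integrable_mult_square_integrable:
  assumes "ess_bounded a" "integrable lebesgue a" "square_integrable u"
  shows "integrable lebesgue (\<lambda>x. a x * u x)"
proof -
  obtain C where C: "AE x in lebesgue. cmod (a x) \<le> C"
    using assms by (auto simp: ess_bounded_def)
  show ?thesis
  proof (rule Bochner_Integration.integrable_bound)
  have am: "a \<in> borel_measurable lebesgue" and um: "u \<in> borel_measurable lebesgue"
    using assms by (auto simp: square_integrable_def ess_bounded_def)
  show "(\<lambda>x. a x * u x) \<in> borel_measurable lebesgue"
    by (intro borel_measurable_times am um)
  show "integrable lebesgue (\<lambda>x. cmod (a x) + C * (cmod (u x))\<^sup>2)"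
    using assms by (intro Bochner_Integration.integrable_add integrable_norm integrable_mult_right)
      (auto simp: square_integrable_def)
  show "AE x in lebesgue. norm (a x * u x) \<le> norm (cmod (a x) + C * (cmod (u x))\<^sup>2)"
    using C
  proof eventually_elim
    case (elim x)
    have "cmod (u x) \<le> 1 + (cmod (u x))\<^sup>2"
      using sum_power2_ge_zero[of "cmod (u x) - 1/2" 0] by (simp add: power2_eq_square algebra_simps)
    then have "cmod (a x) * cmod (u x) \<le> cmod (a x) * (1 + (cmod (u x))\<^sup>2)"
      by (intro mult_left_mono) auto
    also have "\<dots> \<le> cmod (a x) + C * (cmod (u x))\<^sup>2"
      using elim by (simp add: distrib_left mult_right_mono)
    finally show ?case by (simp add: norm_mult)
  qed
qed
qed

lemma test_function_bound:
  assumes "test_function \<phi>"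
  obtains B C where "\<And>x. cmod (\<phi> x) \<le> C * indicator {-B..B} x"
proof -
  have "bounded {x. \<phi> x \<noteq> 0}" using assms by (simp add: test_function_iff)
  then obtain B where B: "\<And>x. \<phi> x \<noteq> 0 \<Longrightarrow> \<bar>x\<bar> \<le> B" by (auto simp: bounded_iff)
  have cont: "continuous_on {-B..B} \<phi>" using assms by (simp add: test_function_iff smooth_continuous)
  obtain C where C: "\<And>x. x \<in> {-B..B} \<Longrightarrow> cmod (\<phi> x) \<le> C"
    using compact_imp_bounded[OF compact_continuous_image[OF cont compact_Icc]]
    unfolding bounded_iff by blast
  show ?thesis
  proof
    show "cmod (\<phi> x) \<le> C * indicator {-B..B} x" for x
      using B[of x] C[of x] by (cases "\<phi> x = 0") (auto simp: indicator_def abs_le_iff)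
  qed
qed

lemma test_function_measurable: "test_function \<phi> \<Longrightarrow> \<phi> \<in> borel_measurable lebesgue"
  by (simp add: test_function_iff smooth_measurable)

lemma test_function_square_integrable:
  assumes "test_function \<phi>" shows "square_integrable \<phi>"
proof -
  obtain B C where bound: "\<And>x. cmod (\<phi> x) \<le> C * indicator {-B..B} x"
    using test_function_bound[OF assms] by blast
  have m: "\<phi> \<in> borel_measurable lebesgue" by (rule test_function_measurable[OF assms])
  have "integrable lebesgue (\<lambda>x. (cmod (\<phi> x))\<^sup>2)"
  proof (rule Bochner_Integration.integrable_bound)
    show "integrable lebesgue (\<lambda>x. C\<^sup>2 * indicator {-B..B} x)"
      by (intro integrable_mult_right integrable_indicator_Icc)
    show "(\<lambda>x. (cmod (\<phi> x))\<^sup>2) \<in> borel_measurable lebesgue"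
      by (intro borel_measurable_power measurable_compose[OF m borel_measurable_norm])
    show "AE x in lebesgue. norm ((cmod (\<phi> x))\<^sup>2) \<le> norm (C\<^sup>2 * indicator {-B..B} x)"
    proof (rule AE_I2)
      fix x show "norm ((cmod (\<phi> x))\<^sup>2) \<le> norm (C\<^sup>2 * indicator {-B..B} x)"
        using power_mono[OF bound norm_ge_zero, of x 2]
        by (cases "x \<in> {-B..B}") simp_all
    qed
  qed
  with m show ?thesis by (simp add: square_integrable_def)
qed

lemma integrable_square_integrable_mult:
  assumes "square_integrable f" "square_integrable g"
  shows "integrable lebesgue (\<lambda>x. f x * g x)"
proof (rule Bochner_Integration.integrable_bound)
  show "integrable lebesgue (\<lambda>x. (cmod (f x))\<^sup>2 + (cmod (g x))\<^sup>2)"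
    using assms by (auto simp: square_integrable_def)
  show "(\<lambda>x. f x * g x) \<in> borel_measurable lebesgue"
    using assms by (intro borel_measurable_times) (auto simp: square_integrable_def)
  have "s * t \<le> s\<^sup>2 + t\<^sup>2" if "s \<ge> 0" "t \<ge> 0" for s t :: real
    using sum_squares_bound[of s t] mult_nonneg_nonneg[OF that] by linarith
  then show "AE x in lebesgue. norm (f x * g x) \<le> norm ((cmod (f x))\<^sup>2 + (cmod (g x))\<^sup>2)"
    by (simp add: norm_mult)
qed

section \<open>A pointwise bound for weak solutions of \<open>p' = \<mu> p + F\<close>\<close>

lemma indicator_Ioc_shift: "indicator {0<..h} (x - c) = indicator {c<..c + h::real} x"
  by (auto simp: indicator_def)

text \<open>For \<open>h > 0\<close>, the piecewise linear function that is \<open>0\<close> on the left of \<open>0\<close>, \<open>1\<close> on the right of \<open>h\<close>, and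
  \<open>x / h\<close> in between.\<close>

definition ramp :: "real \<Rightarrow> real \<Rightarrow> real" where
  "ramp h x = (max x 0 - max (x - h) 0) / h"

text \<open>Smooth monotone functions \<open>K n\<close>, each equal to \<open>0\<close> on the left of \<open>0\<close> and to \<open>1\<close> on the right
  of \<open>h + 1\<close>, that approximate the ramp, with derivatives bounded uniformly in \<open>n\<close>. With \<open>L\<close>
  a primitive of the smooth step, \<open>L (n x) / n\<close> tends to the positive part of \<open>x\<close>.\<close>

lemma smooth_ramp_exists:
  fixes h :: real assumes h: "h > 0"
  obtains K K' :: "nat \<Rightarrow> real \<Rightarrow> real"
  where "\<And>n x. (K n has_real_derivative K' n x) (at x)" "\<And>n. smooth (\<lambda>x. of_real (K n x))"
    "\<And>n. smooth (\<lambda>x. of_real (K' n x))"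
    "\<And>n x. x \<le> 0 \<Longrightarrow> K n x = 0" "\<And>n x. x \<ge> h + 1 \<Longrightarrow> K n x = 1"
    "\<And>n x. 0 \<le> K n x" "\<And>n x. K n x \<le> 1" "\<And>n x. 0 \<le> K' n x"
    "\<And>n x. K' n x \<le> indicator {0..h+1} x / h"
    "\<And>x. (\<lambda>n. K n x) \<longlonglongrightarrow> ramp h x"
    "\<And>x. (\<lambda>n. K' n x) \<longlonglongrightarrow> indicator {0<..h} x / h"
proof -
  obtain J J' :: "real \<Rightarrow> real"
    where J: "\<And>x. (J has_real_derivative J' x) (at x)" and sJ: "smooth (\<lambda>x. of_real (J x))"
    and J0: "\<And>x. x \<le> 0 \<Longrightarrow> J x = 0" and J1: "\<And>x. x \<ge> 1 \<Longrightarrow> J x = 1"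
    and J_nonneg: "\<And>x. 0 \<le> J x" and J_le1: "\<And>x. J x \<le> 1" and J'0: "\<And>x. 0 \<le> J' x"
  proof (rule smooth_step_exists, goal_cases)
    case (1 J J' C)
    show ?case by (rule 1(1)[OF 1(2-8)])
  qed
  have mono_J: "J x \<le> J y" if "x \<le> y" for x y
    using DERIV_nonneg_imp_nondecreasing[of x y J] that J J'0 by blast
  have cont_J: "continuous_on S J" for S
    by (intro continuous_at_imp_continuous_on ballI DERIV_isCont[OF J])
  obtain L0 where L0: "\<And>x. (L0 has_real_derivative J x) (at x)"
    using continuous_has_primitive[OF cont_J] by blast
  define L where "L x = L0 x - L0 0" for x
  have L: "(L has_real_derivative J x) (at x)" for x
    unfolding L_def by (auto intro!: derivative_eq_intros L0)
  have cont_L: "continuous_on S L" for S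
    by (intro continuous_at_imp_continuous_on ballI DERIV_isCont[OF L])
  have L_left: "L x = 0" if "x \<le> 0" for x
  proof (cases "x = 0")
    case False
    with that have "x < 0" by simp
    moreover have "(L has_real_derivative 0) (at y)" if "y < 0" for y
      using L[of y] J0[of y] that by simp
    ultimately show ?thesis
      using DERIV_isconst_end[of x 0 L] cont_L by (simp add: L_def)
  qed (simp add: L_def)
  have L_right: "L x = L 1 + (x - 1)" if "x \<ge> 1" for x
  proof (cases "x = 1")
    case False
    with that have x: "1 < x" by simp
    have "((\<lambda>y. L y - y) has_real_derivative 0) (at y)" if "1 < y" for y
      using L[of y] J1[of y] that by (auto intro!: derivative_eq_intros)
    moreover have "continuous_on {1..x} (\<lambda>y. L y - y)"
      by (intro continuous_intros cont_L)
    ultimately show ?thesis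
      using DERIV_isconst_end[of 1 x "\<lambda>y. L y - y"] x by simp
  qed simp
  have mono_L: "L x \<le> L y" if "x \<le> y" for x y
    using DERIV_nonneg_imp_nondecreasing[of x y L] that L J_nonneg by blast
  have L1: "L 1 \<le> 1"
  proof -
    have "\<exists>y. ((\<lambda>x. x - L x) has_real_derivative y) (at x) \<and> 0 \<le> y" for x
      using J_le1[of x] by (intro exI[of _ "1 - J x"]) (auto intro!: derivative_eq_intros L)
    then have "0 - L 0 \<le> 1 - L 1"
      by (intro DERIV_nonneg_imp_nondecreasing[of 0 1 "\<lambda>x. x - L x"]) auto
    then show ?thesis by (simp add: L_def)
  qed
  \<comment> \<open>This makes the distance from \<open>L (n x) / n\<close> to the positive part of \<open>x\<close> at most \<open>1 / n\<close>.\<close>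
  have L_max: "\<bar>L x - max x 0\<bar> \<le> 1" for x
  proof -
    consider "x \<le> 0" | "0 \<le> x" "x \<le> 1" | "x \<ge> 1" by linarith
    then show ?thesis
    proof cases
      case 2
      then show ?thesis
        using mono_L[of 0 x] mono_L[of x 1] L1 L_left[of 0] by auto
    next
      case 3
      then show ?thesis
        using mono_L[of 0 1] L1 L_left[of 0] L_right[of x] by auto
    qed (simp add: L_left)
  qed
  have lim_L: "(\<lambda>n. L (real (Suc n) * y) / real (Suc n)) \<longlonglongrightarrow> max y 0" for y
  proof (rule LIM_zero_cancel, rule tendsto_rabs_zero_cancel)
    have "\<bar>L (real (Suc n) * y) / real (Suc n) - max y 0\<bar> \<le> 1 / real (Suc n)" for n
    proof -
      have "max (real (Suc n) * y) 0 = real (Suc n) * max y 0"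
        by (simp add: max_def zero_le_mult_iff mult_le_0_iff)
      then have "L (real (Suc n) * y) / real (Suc n) - max y 0
          = (L (real (Suc n) * y) - max (real (Suc n) * y) 0) / real (Suc n)"
        by (simp add: field_simps)
      then show ?thesis
        using L_max[of "real (Suc n) * y"] by (simp add: divide_right_mono)
    qed
    then show "(\<lambda>n. \<bar>L (real (Suc n) * y) / real (Suc n) - max y 0\<bar>) \<longlonglongrightarrow> 0"
      by (intro tendsto_sandwich[OF _ _ tendsto_const lim_1_over_n[THEN LIMSEQ_Suc]]) auto
  qed
  have lim_J: "(\<lambda>n. J (real (Suc n) * y)) \<longlonglongrightarrow> indicator {0<..} y" for y
  proof (cases "y > 0")
    case True
    obtain N where "1 / y < real N" using reals_Archimedean2 by blast
    then have N: "1 \<le> real (Suc n) * y" if "n \<ge> N" for n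
    proof -
      have "1 / y \<le> real (Suc n)" using \<open>1 / y < real N\<close> that by linarith
      then show ?thesis using True by (simp add: field_simps)
    qed
    then have "\<forall>\<^sub>F n in sequentially. J (real (Suc n) * y) = 1"
      unfolding eventually_sequentially using J1 by blast
    with True show ?thesis by (simp add: tendsto_eventually)
  next
    case False
    then have "J (real (Suc n) * y) = 0" for n
      by (intro J0) (simp add: mult_nonneg_nonpos)
    with False show ?thesis by simp
  qed
  define K where "K n x = (L (real (Suc n) * x) / real (Suc n)
      - L (real (Suc n) * (x - h)) / real (Suc n)) / h" for n x
  define K' where "K' n x = (J (real (Suc n) * x) - J (real (Suc n) * (x - h))) / h" for n x
  have K: "(K n has_real_derivative K' n x) (at x)" for n x
  proof -
    have "((\<lambda>x. L (real (Suc n) * (x - c)) / real (Suc n)) has_real_derivative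
        J (real (Suc n) * (x - c))) (at x)" for c
    proof -
      have "((\<lambda>x. real (Suc n) * (x - c)) has_real_derivative real (Suc n)) (at x)"
        by (auto intro!: derivative_eq_intros)
      from DERIV_cdivide[OF DERIV_chain2[OF L this], of "real (Suc n)"] show ?thesis
        by (simp del: of_nat_Suc)
    qed
    from DERIV_cdivide[OF DERIV_diff[OF this[of 0] this[of h]], of h] show ?thesis
      by (simp add: K_def[abs_def] K'_def)
  qed
  have sK': "smooth (\<lambda>x. of_real (K' n x))" for n
    using smooth_cmult[OF smooth_diff[OF smooth_affine[OF sJ, of "real (Suc n)" 0]
          smooth_affine[OF sJ, of "real (Suc n)" "- real (Suc n) * h"]], of "inverse (of_real h)"]
    by (simp add: K'_def field_simps)
  have sK: "smooth (\<lambda>x. of_real (K n x))" for n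
    by (rule smooth_primitive[OF has_vector_derivative_of_real_comp[OF K] sK'])
  have K_left: "K n x = 0" if "x \<le> 0" for n x
    using that h by (simp add: K_def L_left mult_nonneg_nonpos)
  have K_right: "K n x = 1" if "x \<ge> h + 1" for n x
  proof -
    have "1 \<le> real (Suc n) * (x - h)"
      using mult_mono[of 1 "real (Suc n)" 1 "x - h"] that by simp
    moreover have "real (Suc n) * (x - h) \<le> real (Suc n) * x"
      using h by (intro mult_left_mono) auto
    ultimately have "L (real (Suc n) * x) - L (real (Suc n) * (x - h)) = real (Suc n) * h"
      using L_right[of "real (Suc n) * x"] L_right[of "real (Suc n) * (x - h)"]
      by (simp add: algebra_simps)
    then show ?thesis
      using h by (simp add: K_def diff_divide_distrib[symmetric] del: of_nat_Suc)
  qed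
  have K'0: "0 \<le> K' n x" for n x
    unfolding K'_def using h by (intro divide_nonneg_pos) (auto intro!: mono_J mult_left_mono)
  have mono_K: "K n x \<le> K n y" if "x \<le> y" for n x y
    using DERIV_nonneg_imp_nondecreasing[of x y "K n"] that K K'0 by blast
  have K'_le: "K' n x \<le> indicator {0..h+1} x / h" for n x
  proof -
    consider "x < 0" | "x > h + 1" | "x \<in> {0..h+1}" by fastforce
    then show ?thesis
    proof cases
      case 1
      then show ?thesis using h by (simp add: K'_def J0 mult_nonneg_nonpos)
    next
      case 2
      have "1 \<le> real (Suc n) * (x - h)"
        using mult_mono[of 1 "real (Suc n)" 1 "x - h"] 2 by simp
      moreover have "real (Suc n) * (x - h) \<le> real (Suc n) * x"
        using h by (intro mult_left_mono) auto
      ultimately have "J (real (Suc n) * x) = 1" "J (real (Suc n) * (x - h)) = 1"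
        using J1 order.trans by blast+
      then show ?thesis using 2 h by (simp add: K'_def del: of_nat_Suc)
    next
      case 3
      then show ?thesis using h J_le1[of "real (Suc n) * x"] J_nonneg[of "real (Suc n) * (x - h)"]
        by (simp add: K'_def divide_right_mono)
    qed
  qed
  show ?thesis
  proof (rule that[OF K sK sK' K_left K_right _ _ K'0 K'_le])
    show "0 \<le> K n x" for n x
      using mono_K[of 0 x n] K_left[of x n] K_left[of 0 n] by (cases "x \<le> 0") auto
    show "K n x \<le> 1" for n x
      using mono_K[of x "h + 1" n] K_right[of x n] K_right[of "h + 1" n] by (cases "x \<le> h + 1") auto
    show "(\<lambda>n. K n x) \<longlonglongrightarrow> ramp h x" for x
      unfolding K_def ramp_def using h by (intro tendsto_intros lim_L) auto
    have "(\<lambda>n. K' n x) \<longlonglongrightarrow> (indicator {0<..} x - indicator {0<..} (x - h)) / h" for x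
      unfolding K'_def using h by (intro tendsto_intros lim_J) auto
    moreover have "indicator {0<..} x - indicator {0<..} (x - h) = (indicator {0<..h} x :: real)" for x
      using h by (auto simp: indicator_def)
    ultimately show "(\<lambda>n. K' n x) \<longlonglongrightarrow> indicator {0<..h} x / h" for x by simp
  qed auto
qed

lemma has_vector_derivative_exp_mult:
  fixes \<mu> :: complex
  assumes "(W has_real_derivative W') (at x)"
  shows "((\<lambda>x. exp (\<mu> * of_real x) * of_real (W x)) has_vector_derivative
    \<mu> * (exp (\<mu> * of_real x) * of_real (W x)) + exp (\<mu> * of_real x) * of_real W') (at x)"
proof -
  have "((\<lambda>z. exp (\<mu> * z)) has_field_derivative \<mu> * exp (\<mu> * of_real x)) (at (of_real x))"
    by (auto intro!: derivative_eq_intros)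
  then have "((\<lambda>x. exp (\<mu> * of_real x)) has_vector_derivative \<mu> * exp (\<mu> * of_real x)) (at x)"
    by (rule has_vector_derivative_real_field)
  from has_vector_derivative_mult[OF this has_vector_derivative_of_real_comp[OF assms]]
  show ?thesis by (simp add: algebra_simps)
qed

text \<open>The equation tested with \<open>exp (- \<mu> x)\<close> times the trapezoid with edges over \<open>[s, s + h]\<close> and
  \<open>[s + R, s + R + h]\<close>. The exponential cancels the term \<open>\<mu> p\<close>, and only local means of \<open>p\<close>
  and an integral of \<open>F\<close> remain. For \<open>R < 0\<close> the trapezoid is negative.\<close>

lemma weak_ode_trapezoid:
  fixes p F :: "real \<Rightarrow> complex" and s R h :: real
  assumes p: "square_integrable p" and F: "integrable lebesgue F" and h: "h > 0"
    and weak: "\<And>\<phi>. test_function \<phi> \<Longrightarrow>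
      (LINT x|lebesgue. p x * ddx \<phi> x) = - (LINT x|lebesgue. (\<mu> * p x + F x) * \<phi> x)"
  defines "E \<equiv> \<lambda>x. exp (- \<mu> * complex_of_real x)"
  shows "(LINT x|lebesgue. p x * (E x * of_real
        (indicator {s<..s + h} x / h - indicator {s + R<..s + R + h} x / h)))
    = - (LINT x|lebesgue. F x * (E x * of_real (ramp h (x - s) - ramp h (x - (s + R)))))"
proof -
  obtain K K' :: "nat \<Rightarrow> real \<Rightarrow> real" where
    K: "\<And>n x. (K n has_real_derivative K' n x) (at x)" and sK: "\<And>n. smooth (\<lambda>x. of_real (K n x))"
    and sK': "\<And>n. smooth (\<lambda>x. of_real (K' n x))"
    and K_left: "\<And>n x. x \<le> 0 \<Longrightarrow> K n x = 0" and K_right: "\<And>n x. x \<ge> h + 1 \<Longrightarrow> K n x = 1"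
    and K_nonneg: "\<And>n x. 0 \<le> K n x" and K_le: "\<And>n x. K n x \<le> 1" and K'_nonneg: "\<And>n x. 0 \<le> K' n x"
    and K'_le: "\<And>n x. K' n x \<le> indicator {0..h+1} x / h"
    and lim_K: "\<And>x. (\<lambda>n. K n x) \<longlonglongrightarrow> ramp h x"
    and lim_K': "\<And>x. (\<lambda>n. K' n x) \<longlonglongrightarrow> indicator {0<..h} x / h"
  proof (rule smooth_ramp_exists[OF h], goal_cases)
    case (1 K K')
    show ?case by (rule 1(1)[OF 1(2-12)])
  qed
  define A B where "A = min s (s + R)" and "B = max s (s + R) + h + 1"
  define W where "W n x = K n (x - s) - K n (x - (s + R))" for n x
  define W' where "W' n x = K' n (x - s) - K' n (x - (s + R))" for n x
  define \<phi> where "\<phi> n x = E x * of_real (W n x)" for n x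
  have W: "(W n has_real_derivative W' n x) (at x)" for n x
    unfolding W_def W'_def by (auto intro!: derivative_eq_intros DERIV_chain'[OF _ K])
  have sW: "smooth (\<lambda>x. of_real (W n x))" for n
    using smooth_diff[OF smooth_affine[OF sK, where m = 1 and b = "- s"] smooth_affine[OF sK, where m = 1 and b = "- (s + R)"]]
    by (simp add: W_def algebra_simps)
  have sW': "smooth (\<lambda>x. of_real (W' n x))" for n
    using smooth_diff[OF smooth_affine[OF sK', where m = 1 and b = "- s"] smooth_affine[OF sK', where m = 1 and b = "- (s + R)"]]
    by (simp add: W'_def algebra_simps)
  have W_out: "W n x = 0" if "x \<notin> {A..B}" for n x
  proof -
    have "x \<le> s \<and> x \<le> s + R \<or> x - s \<ge> h + 1 \<and> x - (s + R) \<ge> h + 1"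
      using that by (auto simp: A_def B_def min_def max_def split: if_splits)
    then show ?thesis by (auto simp: W_def K_left K_right)
  qed
  have W'_out: "W' n x = 0" if "x \<notin> {A..B}" for n x
  proof -
    have "x - s \<notin> {0..h+1}" "x - (s + R) \<notin> {0..h+1}"
      using that by (auto simp: A_def B_def min_def max_def split: if_splits)
    then show ?thesis
      using K'_le[where n=n and x="x - s"] K'_le[where n=n and x="x - (s + R)"]
        K'_nonneg[of n "x - s"] K'_nonneg[of n "x - (s + R)"] by (simp add: W'_def)
  qed
  have W_le: "\<bar>W n x\<bar> \<le> 1" for n x
    using K_nonneg[of n "x - s"] K_nonneg[of n "x - (s + R)"] K_le[of n "x - s"] K_le[of n "x - (s + R)"]
    by (auto simp: W_def)
  have K'_le': "K' n x \<le> 1 / h" for n x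
    by (rule order.trans[OF K'_le]) (use h in \<open>auto simp: indicator_def\<close>)
  have W'_le: "\<bar>W' n x\<bar> \<le> 1 / h" for n x
    using K'_nonneg[of n "x - s"] K'_nonneg[of n "x - (s + R)"] K'_le'[of n "x - s"] K'_le'[of n "x - (s + R)"]
    by (auto simp: W'_def)
  have sE: "smooth E"
    using smooth_exp[of 1 "- \<mu>"] by (simp add: E_def)
  obtain C where C: "\<And>x. x \<in> {A..B} \<Longrightarrow> cmod (E x) \<le> C"
    using compact_imp_bounded[OF compact_continuous_image[OF smooth_continuous[OF sE] compact_Icc[of A B]]]
    unfolding bounded_iff by blast
  have EW_le: "cmod (E x * of_real (W n x)) \<le> C * indicator {A..B} x" for n x
    using mult_mono[OF C[of x] W_le[of n x]] W_out[of x n] order.trans[OF norm_ge_zero C[of x]]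
    by (cases "x \<in> {A..B}") (simp_all add: norm_mult)
  have EW'_le: "cmod (E x * of_real (W' n x)) \<le> (C * (1 / h)) * indicator {A..B} x" for n x
    using mult_mono[OF C[of x] W'_le[of n x]] W'_out[of x n] norm_ge_zero[of "E x"] order.trans[OF norm_ge_zero C[of x]]
    by (cases "x \<in> {A..B}") (simp_all add: norm_mult)
  have [measurable]: "p \<in> borel_measurable lebesgue" "F \<in> borel_measurable lebesgue"
      "E \<in> borel_measurable lebesgue"
    using p F sE by (auto simp: square_integrable_def intro: smooth_measurable)
  have EWm[measurable]: "(\<lambda>x. E x * of_real (W n x)) \<in> borel_measurable lebesgue" for n
    by (intro smooth_measurable smooth_mult sE sW)
  have EW'm[measurable]: "(\<lambda>x. E x * of_real (W' n x)) \<in> borel_measurable lebesgue" for n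
    by (intro smooth_measurable smooth_mult sE sW')
  have ddx_\<phi>: "ddx (\<phi> n) = (\<lambda>x. - \<mu> * \<phi> n x + E x * of_real (W' n x))" for n
    unfolding \<phi>_def E_def by (intro ddx_eqI has_vector_derivative_exp_mult W)
  have test: "test_function (\<phi> n)" for n
  proof -
    have "{x. \<phi> n x \<noteq> 0} \<subseteq> {A..B}" using W_out by (force simp: \<phi>_def)
    then have "bounded {x. \<phi> n x \<noteq> 0}" by (rule bounded_subset[rotated]) simp
    moreover have "smooth (\<phi> n)" unfolding \<phi>_def by (intro smooth_mult sE sW)
    ultimately show ?thesis by (simp add: test_function_iff)
  qed
  have int_p: "integrable lebesgue (\<lambda>x. p x * \<phi> n x)" for n
    unfolding \<phi>_def by (rule square_integrable_integrable_mult[OF p EWm EW_le])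
  have int_p': "integrable lebesgue (\<lambda>x. p x * (E x * of_real (W' n x)))" for n
    by (rule square_integrable_integrable_mult[OF p EW'm EW'_le])
  have bound_F: "cmod (F x * (E x * of_real (W n x))) \<le> \<bar>C\<bar> * cmod (F x)" for n x
  proof -
    have "cmod (E x * of_real (W n x)) \<le> \<bar>C\<bar>"
      by (rule order.trans[OF EW_le]) (auto simp: indicator_def)
    from mult_left_mono[OF this, of "cmod (F x)"] show ?thesis
      by (simp add: norm_mult mult_ac)
  qed
  have int_F: "integrable lebesgue (\<lambda>x. F x * \<phi> n x)" for n
    unfolding \<phi>_def
  proof (rule Bochner_Integration.integrable_bound)
    show "integrable lebesgue (\<lambda>x. \<bar>C\<bar> * cmod (F x))"
      by (intro integrable_mult_right integrable_norm F)
    show "(\<lambda>x. F x * (E x * of_real (W n x))) \<in> borel_measurable lebesgue"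
      by measurable
    show "AE x in lebesgue. norm (F x * (E x * of_real (W n x))) \<le> norm (\<bar>C\<bar> * cmod (F x))"
      using bound_F by (intro always_eventually allI) (simp add: abs_mult)
  qed
  have eq: "(LINT x|lebesgue. p x * (E x * of_real (W' n x))) = - (LINT x|lebesgue. F x * (E x * of_real (W n x)))" for n
  proof -
    have "(LINT x|lebesgue. p x * ddx (\<phi> n) x)
        = (LINT x|lebesgue. (- \<mu>) * (p x * \<phi> n x) + p x * (E x * of_real (W' n x)))"
      by (simp add: ddx_\<phi> algebra_simps)
    also have "\<dots> = - \<mu> * (LINT x|lebesgue. p x * \<phi> n x) + (LINT x|lebesgue. p x * (E x * of_real (W' n x)))"
      by (subst Bochner_Integration.integral_add)
         (intro integrable_mult_right int_p int_p' | simp)+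
    finally have 1: "(LINT x|lebesgue. p x * ddx (\<phi> n) x) = \<dots>" .
    have "(LINT x|lebesgue. (\<mu> * p x + F x) * \<phi> n x) = (LINT x|lebesgue. \<mu> * (p x * \<phi> n x) + F x * \<phi> n x)"
      by (simp add: algebra_simps)
    also have "\<dots> = \<mu> * (LINT x|lebesgue. p x * \<phi> n x) + (LINT x|lebesgue. F x * \<phi> n x)"
      by (subst Bochner_Integration.integral_add)
         (intro integrable_mult_right int_p int_F | simp)+
    finally show ?thesis
      using weak[OF test[of n]] 1 by (simp add: \<phi>_def)
  qed
  let ?w' = "\<lambda>x. indicator {0<..h} (x - s) / h - indicator {0<..h} (x - (s + R)) / h"
  let ?w = "\<lambda>x. ramp h (x - s) - ramp h (x - (s + R))"
  have mR: "(\<lambda>x. ramp h (x - c)) \<in> borel_measurable lebesgue" for c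
    unfolding ramp_def by (intro continuous_borel_measurable_lebesgue continuous_intros) (use h in auto)
  have mI: "(\<lambda>x. indicator {0<..h} (x - c) :: real) \<in> borel_measurable lebesgue" for c
    unfolding indicator_Ioc_shift by (rule borel_measurable_indicator) simp
  note [measurable] = mR mI
  \<comment> \<open>The smooth identity passes to the limit on both sides by dominated convergence.\<close>
  have "(\<lambda>n. LINT x|lebesgue. p x * (E x * of_real (W' n x))) \<longlonglongrightarrow> (LINT x|lebesgue. p x * (E x * of_real (?w' x)))"
  proof (rule integral_dominated_convergence)
    show "integrable lebesgue (\<lambda>x. (C * (1 / h)) * (indicator {A..B} x * cmod (p x)))"
      by (intro integrable_mult_right square_integrable_integrable_Icc p)
    show "AE x in lebesgue. (\<lambda>n. p x * (E x * of_real (W' n x))) \<longlonglongrightarrow> p x * (E x * of_real (?w' x))"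
      unfolding W'_def by (intro always_eventually allI tendsto_intros lim_K')
    show "AE x in lebesgue. norm (p x * (E x * of_real (W' n x))) \<le> (C * (1 / h)) * (indicator {A..B} x * cmod (p x))" for n
      using mult_left_mono[OF EW'_le norm_ge_zero[of "p _"]]
      by (intro always_eventually allI) (simp add: norm_mult mult_ac)
  qed measurable
  moreover have "(\<lambda>n. LINT x|lebesgue. F x * (E x * of_real (W n x))) \<longlonglongrightarrow> (LINT x|lebesgue. F x * (E x * of_real (?w x)))"
  proof (rule integral_dominated_convergence)
    show "integrable lebesgue (\<lambda>x. \<bar>C\<bar> * cmod (F x))"
      using F by simp
    show "AE x in lebesgue. (\<lambda>n. F x * (E x * of_real (W n x))) \<longlonglongrightarrow> F x * (E x * of_real (?w x))"
      unfolding W_def by (intro always_eventually allI tendsto_intros lim_K)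
    show "AE x in lebesgue. norm (F x * (E x * of_real (W n x))) \<le> \<bar>C\<bar> * cmod (F x)" for n
      using bound_F by simp
  qed measurable
  ultimately show ?thesis
    unfolding eq indicator_Ioc_shift using LIMSEQ_unique tendsto_minus by blast
qed

lemma square_integrable_tail_tendsto_0:
  fixes R :: "nat \<Rightarrow> real"
  assumes p: "square_integrable p" and h: "h > 0" and R: "filterlim (\<lambda>n. \<bar>R n\<bar>) at_top sequentially"
  shows "(\<lambda>n. LINT x|lebesgue. indicator {s + R n<..s + R n + h} x * cmod (p x)) \<longlonglongrightarrow> 0"
    (is "?a \<longlonglongrightarrow> 0")
proof -
  let ?I = "\<lambda>n. indicator {s + R n<..s + R n + h} :: real \<Rightarrow> real"
  have pm: "p \<in> borel_measurable lebesgue" and p2: "integrable lebesgue (\<lambda>x. (cmod (p x))\<^sup>2)"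
    using p by (auto simp: square_integrable_def)
  have norm_m: "(\<lambda>x. cmod (p x)) \<in> borel_measurable lebesgue"
    by (rule measurable_compose[OF pm borel_measurable_norm])
  have int_I: "integrable lebesgue (?I n)" and LINT_I: "(LINT x|lebesgue. ?I n x) = h" for n
    using h by (simp_all add: integrable_indicator_iff)
  have m2: "(\<lambda>x. ?I n x * (cmod (p x))\<^sup>2) \<in> borel_measurable lebesgue" for n
    by (intro borel_measurable_times borel_measurable_power norm_m borel_measurable_indicator) simp
  have int2: "integrable lebesgue (\<lambda>x. ?I n x * (cmod (p x))\<^sup>2)" for n
    by (rule Bochner_Integration.integrable_bound[OF p2 m2]) (auto simp: indicator_def)
  have int1: "integrable lebesgue (\<lambda>x. ?I n x * cmod (p x))" for n
  proof (rule Bochner_Integration.integrable_bound)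
    show "integrable lebesgue (\<lambda>x. indicator {s + R n..s + R n + h} x * cmod (p x))"
      by (rule square_integrable_integrable_Icc[OF p])
    show "(\<lambda>x. ?I n x * cmod (p x)) \<in> borel_measurable lebesgue"
      by (intro borel_measurable_times norm_m borel_measurable_indicator) simp
  qed (auto simp: indicator_def)
  have "(\<lambda>n. LINT x|lebesgue. ?I n x * (cmod (p x))\<^sup>2) \<longlonglongrightarrow> integral\<^sup>L lebesgue (\<lambda>x::real. 0::real)"
  proof (rule integral_dominated_convergence)
    show "integrable lebesgue (\<lambda>x. (cmod (p x))\<^sup>2)" by (rule p2)
    show "(\<lambda>x. ?I n x * (cmod (p x))\<^sup>2) \<in> borel_measurable lebesgue" for n by (rule m2)
    show "AE x in lebesgue. (\<lambda>n. ?I n x * (cmod (p x))\<^sup>2) \<longlonglongrightarrow> 0"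
    proof (rule AE_I2, rule tendsto_eventually)
      fix x
      have "\<forall>\<^sub>F n in sequentially. \<bar>x - s\<bar> + h < \<bar>R n\<bar>"
        using R by (simp add: filterlim_at_top_dense)
      then show "\<forall>\<^sub>F n in sequentially. ?I n x * (cmod (p x))\<^sup>2 = 0"
        by eventually_elim (use h in \<open>auto simp: indicator_def\<close>)
    qed
  qed (auto simp: indicator_def)
  then have b: "(\<lambda>n. LINT x|lebesgue. ?I n x * (cmod (p x))\<^sup>2) \<longlonglongrightarrow> 0" by simp
  show ?thesis
  proof (rule tendstoI)
    fix e :: real assume e: "e > 0"
    define \<epsilon> where "\<epsilon> = e / (2 * h)"
    have \<epsilon>: "\<epsilon> > 0" using e h by (simp add: \<epsilon>_def)
    have "\<forall>\<^sub>F n in sequentially. (LINT x|lebesgue. ?I n x * (cmod (p x))\<^sup>2) < \<epsilon> * (e / 2)"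
      by (intro order_tendstoD(2)[OF b] mult_pos_pos) (use e \<epsilon> in auto)
    then show "\<forall>\<^sub>F n in sequentially. dist (?a n) 0 < e"
    proof eventually_elim
      case (elim n)
      \<comment> \<open>A substitute for the Cauchy-Schwarz inequality on an interval of length \<open>h\<close>.\<close>
      have le: "t \<le> \<epsilon> + t\<^sup>2 / \<epsilon>" if "t \<ge> 0" for t
      proof (cases "t \<le> \<epsilon>")
        case False
        then have "\<epsilon> * t \<le> t\<^sup>2" using that by (simp add: power2_eq_square mult_right_mono)
        then have "t \<le> t\<^sup>2 / \<epsilon>" using \<epsilon> by (simp add: field_simps)
        then show ?thesis using \<epsilon> by simp
      qed (use \<epsilon> in \<open>simp add: add_increasing2\<close>)
      have "?a n \<le> (LINT x|lebesgue. \<epsilon> * ?I n x + (?I n x * (cmod (p x))\<^sup>2) / \<epsilon>)"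
      proof (rule integral_mono)
        show "?I n x * cmod (p x) \<le> \<epsilon> * ?I n x + (?I n x * (cmod (p x))\<^sup>2) / \<epsilon>" for x
          using le[of "cmod (p x)"] by (simp add: indicator_def)
      qed (intro int1 int2 int_I Bochner_Integration.integrable_add integrable_mult_right
          integrable_divide)+
      also have "\<dots> = \<epsilon> * h + (LINT x|lebesgue. ?I n x * (cmod (p x))\<^sup>2) / \<epsilon>"
        by (subst Bochner_Integration.integral_add)
           (use int_I int2 LINT_I in \<open>simp_all\<close>)
      also have "\<dots> < \<epsilon> * h + \<epsilon> * (e / 2) / \<epsilon>"
        using elim \<epsilon> by (intro add_strict_left_mono divide_strict_right_mono)
      also have "\<dots> = e" using \<epsilon> h by (simp add: \<epsilon>_def)
      finally show ?case
        by (simp add: abs_of_nonneg)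
    qed
  qed
qed

lemma ramp_bounds: "h > 0 \<Longrightarrow> 0 \<le> ramp h x" "h > 0 \<Longrightarrow> ramp h x \<le> 1"
  and ramp_left: "x \<le> 0 \<Longrightarrow> h > 0 \<Longrightarrow> ramp h x = 0"
  and ramp_right: "x \<ge> h \<Longrightarrow> h > 0 \<Longrightarrow> ramp h x = 1"
  by (auto simp: ramp_def field_simps)

text \<open>The far edge is sent to \<open>+\<infinity>\<close> or \<open>-\<infinity>\<close> according to the flag \<open>right\<close>, in the direction in
  which \<open>exp (- \<mu> x)\<close> does not grow. For purely imaginary \<open>\<mu>\<close> both directions are admissible; this
  freedom matters below, where \<open>\<mu>\<close> and \<open>-\<mu>\<close> have to be treated with opposite directions. On the left, the
  half-line reaches \<open>s + h\<close> because the edge of the trapezoid covers \<open>[s, s + h]\<close>.\<close>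

lemma weak_ode_average_bound:
  fixes p F :: "real \<Rightarrow> complex" and s h :: real and right :: bool
  assumes dir: "if right then Re \<mu> \<ge> 0 else Re \<mu> \<le> 0"
    and p: "square_integrable p" and F: "integrable lebesgue F" and h: "h > 0"
    and weak: "\<And>\<phi>. test_function \<phi> \<Longrightarrow>
      (LINT x|lebesgue. p x * ddx \<phi> x) = - (LINT x|lebesgue. (\<mu> * p x + F x) * \<phi> x)"
  defines "E \<equiv> \<lambda>x. exp (- \<mu> * complex_of_real x)"
    and "H \<equiv> if right then {s..} else {..s + h}"
  shows "cmod (LINT x|lebesgue. p x * (E x * of_real (indicator {s<..s + h} x / h)))
    \<le> exp (- Re \<mu> * s + \<bar>Re \<mu>\<bar> * h) * (LINT x|lebesgue. indicator H x * cmod (F x))"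
proof -
  define R where "R n = (if right then real n else - real n)" for n
  define M where "M = exp (- Re \<mu> * s + \<bar>Re \<mu>\<bar> * h)"
  have M: "M > 0" by (simp add: M_def)
  have E_le: "cmod (E x) \<le> M" if "x \<in> H" for x
  proof (cases right)
    case True
    with that dir have "Re \<mu> * s \<le> Re \<mu> * x" by (intro mult_left_mono) (auto simp: H_def)
    then have "- Re \<mu> * x \<le> - Re \<mu> * s + \<bar>Re \<mu>\<bar> * h" using True dir h
      by (smt (verit) mult_minus_left mult_nonneg_nonneg)
    then show ?thesis by (simp add: E_def M_def)
  next
    case False
    with that dir have "(- Re \<mu>) * x \<le> (- Re \<mu>) * (s + h)" by (intro mult_left_mono) (auto simp: H_def)
    then have "- Re \<mu> * x \<le> - Re \<mu> * s + \<bar>Re \<mu>\<bar> * h" using False dir by (simp add: algebra_simps)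
    then show ?thesis by (simp add: E_def M_def)
  qed
  have cont_E: "continuous_on UNIV E" unfolding E_def by (intro continuous_intros)
  have Em: "E \<in> borel_measurable lebesgue"
    by (rule continuous_borel_measurable_lebesgue[OF cont_E])
  have Im: "(\<lambda>x. complex_of_real (indicator {c<..c + h} x / h)) \<in> borel_measurable lebesgue" for c
    by (intro measurable_compose[OF _ borel_measurable_of_real] borel_measurable_divide
        borel_measurable_indicator) auto
  have EIm: "(\<lambda>x. E x * of_real (indicator {c<..c + h} x / h)) \<in> borel_measurable lebesgue" for c
    by (intro borel_measurable_times Em Im)
  have int_p: "integrable lebesgue (\<lambda>x. p x * (E x * of_real (indicator {c<..c + h} x / h)))" for c
  proof -
    obtain C where C: "\<And>x. x \<in> {c..c + h} \<Longrightarrow> cmod (E x) \<le> C"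
      using compact_imp_bounded[OF compact_continuous_image[OF continuous_on_subset[OF cont_E subset_UNIV] compact_Icc[of c "c + h"]]]
      unfolding bounded_iff by blast
    show ?thesis
    proof (rule square_integrable_integrable_mult[OF p EIm])
      show "cmod (E x * of_real (indicator {c<..c + h} x / h)) \<le> C / h * indicator {c..c + h} x" for x
        using C[of x] order.trans[OF norm_ge_zero C[of x]] h
          by (auto simp: indicator_def norm_divide divide_right_mono)
    qed
  qed
  define A where "A = (LINT x|lebesgue. p x * (E x * of_real (indicator {s<..s + h} x / h)))"
  define a where "a n = (LINT x|lebesgue. indicator {s + R n<..s + R n + h} x * cmod (p x))" for n
  have "cmod A \<le> M * (LINT x|lebesgue. indicator H x * cmod (F x)) + M / h * a n" for n
  proof -
    define B where "B = (LINT x|lebesgue. p x * (E x * of_real (indicator {s + R n<..s + R n + h} x / h)))"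
    define w where "w x = ramp h (x - s) - ramp h (x - (s + R n))" for x
    have "A - B = (LINT x|lebesgue. p x * (E x * of_real (indicator {s<..s + h} x / h))
        - p x * (E x * of_real (indicator {s + R n<..s + R n + h} x / h)))"
      unfolding A_def B_def by (rule Bochner_Integration.integral_diff[symmetric]) (rule int_p)+
    also have "\<dots> = - (LINT x|lebesgue. F x * (E x * of_real (w x)))"
      using weak_ode_trapezoid[OF p F h weak, of s "R n"] by (simp add: E_def w_def algebra_simps)
    finally have "A = B - (LINT x|lebesgue. F x * (E x * of_real (w x)))" by (simp add: algebra_simps)
    then have "cmod A \<le> cmod B + cmod (LINT x|lebesgue. F x * (E x * of_real (w x)))"
      by (simp add: norm_triangle_ineq4)
    moreover have "cmod (LINT x|lebesgue. F x * (E x * of_real (w x))) \<le> (LINT x|lebesgue. M * (indicator H x * cmod (F x)))"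
    proof (rule Bochner_Integration.integral_norm_bound_integral)
      have Fm: "F \<in> borel_measurable lebesgue" using F by auto
      have wm: "w \<in> borel_measurable lebesgue"
        unfolding w_def[abs_def] ramp_def
        by (intro continuous_borel_measurable_lebesgue continuous_intros) (use h in auto)
      have bound: "norm (F x * (E x * of_real (w x))) \<le> M * (indicator H x * cmod (F x))" for x
      proof (cases "w x = 0")
        case False
        have xH: "x \<in> H"
        proof (rule ccontr)
          assume not: "\<not> ?thesis"
          then have "w x = 0"
          proof (cases right)
            case True
            with not have "x - s \<le> 0" "x - (s + R n) \<le> 0" by (auto simp: R_def H_def)
            then show ?thesis using h by (simp add: w_def ramp_left)
          next
            case False
            with not have "x - s \<ge> h" "x - (s + R n) \<ge> h" by (auto simp: R_def H_def)
            then show ?thesis using h by (simp add: w_def ramp_right)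
          qed
          with False show False by simp
        qed
        then have "cmod (E x) \<le> M" by (rule E_le)
        moreover have "\<bar>w x\<bar> \<le> 1"
          using ramp_bounds[OF h, of "x - s"] ramp_bounds[OF h, of "x - (s + R n)"] by (simp add: w_def)
        ultimately have "cmod (E x) * \<bar>w x\<bar> \<le> M * 1" using M by (intro mult_mono) auto
        from mult_left_mono[OF this, of "cmod (F x)"] show ?thesis
          using xH by (simp add: norm_mult mult_ac)
      qed (use M in simp)
      then show "norm (F x * (E x * of_real (w x))) \<le> M * (indicator H x * cmod (F x))" for x .
      have "integrable lebesgue (\<lambda>x. indicator H x *\<^sub>R cmod (F x))"
        by (intro integrable_mult_indicator integrable_norm F) (simp add: H_def)
      then show intM: "integrable lebesgue (\<lambda>x. M * (indicator H x * cmod (F x)))"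
        by simp
      show "integrable lebesgue (\<lambda>x. F x * (E x * of_real (w x)))"
        by (rule Bochner_Integration.integrable_bound[OF intM])
           (use bound M in \<open>auto intro!: borel_measurable_times Fm Em measurable_compose[OF wm borel_measurable_of_real] simp: abs_mult\<close>)
    qed
    moreover have "cmod B \<le> (LINT x|lebesgue. M / h * (indicator {s + R n<..s + R n + h} x * cmod (p x)))"
      unfolding B_def
    proof (rule Bochner_Integration.integral_norm_bound_integral[OF int_p])
      have bound: "cmod (E x) \<le> M" if "x \<in> {s + R n<..s + R n + h}" for x
        by (rule E_le) (use that h in \<open>auto simp: R_def H_def split: if_splits\<close>)
      show "norm (p x * (E x * of_real (indicator {s + R n<..s + R n + h} x / h)))
          \<le> M / h * (indicator {s + R n<..s + R n + h} x * cmod (p x))" for x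
        using mult_left_mono[OF bound[of x], of "cmod (p x) / h"] h
        by (cases "x \<in> {s + R n<..s + R n + h}") (simp_all add: norm_mult norm_divide mult_ac)
      have pm: "(\<lambda>x. cmod (p x)) \<in> borel_measurable lebesgue"
        using p by (intro measurable_compose[OF _ borel_measurable_norm]) (simp add: square_integrable_def)
      have "integrable lebesgue (\<lambda>x. indicator {s + R n<..s + R n + h} x * cmod (p x))"
      proof (rule Bochner_Integration.integrable_bound[OF square_integrable_integrable_Icc[OF p]])
        show "(\<lambda>x. indicator {s + R n<..s + R n + h} x * cmod (p x)) \<in> borel_measurable lebesgue"
          by (intro borel_measurable_times pm borel_measurable_indicator) simp
        show "AE x in lebesgue. norm (indicator {s + R n<..s + R n + h} x * cmod (p x))
            \<le> norm (indicator {s + R n..s + R n + h} x * cmod (p x))"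
          by (auto simp: indicator_def)
      qed
      then show "integrable lebesgue (\<lambda>x. M / h * (indicator {s + R n<..s + R n + h} x * cmod (p x)))"
        by (rule integrable_mult_right)
    qed
    ultimately show ?thesis by (simp add: a_def)
  qed
  moreover have "a \<longlonglongrightarrow> 0"
    unfolding a_def
  proof (rule square_integrable_tail_tendsto_0[OF p h])
    have "(\<lambda>n. \<bar>R n\<bar>) = real" by (auto simp: R_def)
    then show "filterlim (\<lambda>n. \<bar>R n\<bar>) at_top sequentially"
      by (simp add: filterlim_real_sequentially)
  qed
  then have "(\<lambda>n. M * (LINT x|lebesgue. indicator H x * cmod (F x)) + M / h * a n)
      \<longlonglongrightarrow> M * (LINT x|lebesgue. indicator H x * cmod (F x)) + M / h * 0"
    by (intro tendsto_intros)
  ultimately have "cmod A \<le> M * (LINT x|lebesgue. indicator H x * cmod (F x)) + M / h * 0"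
    by (intro tendsto_lowerbound[OF _ always_eventually]) auto
  then show ?thesis by (simp add: A_def M_def)
qed

text \<open>A solution that is square-integrable is controlled by the inhomogeneity on the half-line
  along which the homogeneous equation grows: the factor \<open>exp (\<mu> (x - y))\<close> in the variation of
  constants formula is at most \<open>1\<close> there.\<close>

lemma weak_ode_bound:
  fixes p F :: "real \<Rightarrow> complex"
  assumes dir: "if right then Re \<mu> \<ge> 0 else Re \<mu> \<le> 0"
    and p: "square_integrable p" and F: "integrable lebesgue F"
    and weak: "\<And>\<phi>. test_function \<phi> \<Longrightarrow>
      (LINT x|lebesgue. p x * ddx \<phi> x) = - (LINT x|lebesgue. (\<mu> * p x + F x) * \<phi> x)"
  shows "AE x in lebesgue. cmod (p x)
    \<le> (LINT y|lebesgue. indicator (if right then {x..} else {..x}) y * cmod (F y))"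
proof -
  define H where "H s h = (if right then {s..} else {..s + h})" for s h :: real
  define I where "I s h = (LINT y|lebesgue. indicator (H s h) y * cmod (F y))" for s h
  have Hm: "(\<lambda>y. indicator (H s h) y * cmod (F y)) \<in> borel_measurable lebesgue" for s h
    using F by (intro borel_measurable_times borel_measurable_indicator
        measurable_compose[OF _ borel_measurable_norm]) (auto simp: H_def)
  define \<delta> where "\<delta> n = 1 / real (Suc n)" for n
  have \<delta>: "\<delta> n > 0" for n by (simp add: \<delta>_def)
  have lim_\<delta>: "\<delta> \<longlonglongrightarrow> 0"
    unfolding \<delta>_def by (rule LIMSEQ_Suc[OF lim_1_over_n])
  have lim_I: "(\<lambda>n. I s (\<delta> n)) \<longlonglongrightarrow> I s 0" for s
    unfolding I_def
  proof (rule integral_dominated_convergence)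
    show "integrable lebesgue (\<lambda>y. cmod (F y))" by (intro integrable_norm F)
    show "AE y in lebesgue. (\<lambda>n. indicator (H s (\<delta> n)) y * cmod (F y))
        \<longlonglongrightarrow> indicator (H s 0) y * cmod (F y)"
    proof (rule AE_I2, rule tendsto_eventually)
      fix y
      have "\<forall>\<^sub>F n in sequentially. y > s \<longrightarrow> \<delta> n < y - s"
        by (cases "y > s") (use order_tendstoD(2)[OF lim_\<delta>, of "y - s"] in auto)
      then show "\<forall>\<^sub>F n in sequentially. indicator (H s (\<delta> n)) y * cmod (F y)
          = indicator (H s 0) y * cmod (F y)"
      proof eventually_elim
        case (elim n)
        then have "y \<in> H s (\<delta> n) \<longleftrightarrow> y \<in> H s 0" using \<delta>[of n] by (auto simp: H_def)
        then show ?case by (simp add: indicator_def)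
      qed
    qed
    show "(\<lambda>y. indicator (H s 0) y * cmod (F y)) \<in> borel_measurable lebesgue"
      "(\<lambda>y. indicator (H s (\<delta> n)) y * cmod (F y)) \<in> borel_measurable lebesgue" for n
      by (rule Hm)+
  qed (auto simp: indicator_def)
  define E where "E x = exp (- \<mu> * complex_of_real x)" for x
  define f where "f x = p x * E x" for x
  have cont_E: "continuous_on UNIV E" unfolding E_def by (intro continuous_intros)
  have Em: "E \<in> borel_measurable lebesgue"
    by (rule continuous_borel_measurable_lebesgue[OF cont_E])
  have set_int: "set_integrable lebesgue {c..d} f" for c d
  proof -
    obtain C where C: "\<And>x. x \<in> {c..d} \<Longrightarrow> cmod (E x) \<le> C"
      using compact_imp_bounded[OF compact_continuous_image[OF continuous_on_subset[OF cont_E subset_UNIV] compact_Icc[of c d]]]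
      unfolding bounded_iff by blast
    have "integrable lebesgue (\<lambda>x. p x * (indicator {c..d} x *\<^sub>R E x))"
    proof (rule square_integrable_integrable_mult[OF p])
      show "(\<lambda>x. indicator {c..d} x *\<^sub>R E x) \<in> borel_measurable lebesgue"
        by (intro borel_measurable_scaleR borel_measurable_indicator Em) simp
      show "cmod (indicator {c..d} x *\<^sub>R E x) \<le> C * indicator {c..d} x" for x
        using C[of x] by (auto simp: indicator_def)
    qed
    then show ?thesis by (simp add: set_integrable_def f_def)
  qed
  have avg: "integral (cbox x (x + h *\<^sub>R One)) f /\<^sub>R h
      = (LINT y|lebesgue. p y * (E y * of_real (indicator {x<..x + h} y / h)))" if "h > 0" for x h
  proof -
    have "integral (cbox x (x + h *\<^sub>R One)) f = (LINT y|lebesgue. indicator {x..x + h} y *\<^sub>R f y)"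
      using set_lebesgue_integral_eq_integral(2)[OF set_int, of x "x + h"]
      by (simp add: set_lebesgue_integral_def)
    also have "\<dots> /\<^sub>R h = (LINT y|lebesgue. (indicator {x..x + h} y *\<^sub>R f y) /\<^sub>R h)"
      by (rule integral_scaleR_right[symmetric])
    also have "\<dots> = (LINT y|lebesgue. p y * (E y * of_real (indicator {x<..x + h} y / h)))"
    proof (rule integral_cong_AE)
      have pm: "p \<in> borel_measurable lebesgue" using p by (simp add: square_integrable_def)
      show "(\<lambda>y. (indicator {x..x + h} y *\<^sub>R f y) /\<^sub>R h) \<in> borel_measurable lebesgue"
        unfolding f_def
        by (intro borel_measurable_scaleR borel_measurable_const borel_measurable_indicator
            borel_measurable_times pm Em) simp
      show "(\<lambda>y. p y * (E y * of_real (indicator {x<..x + h} y / h))) \<in> borel_measurable lebesgue"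
        by (intro borel_measurable_times pm Em measurable_compose[OF _ borel_measurable_of_real]
            borel_measurable_divide borel_measurable_const borel_measurable_indicator) simp
      have "AE y in lebesgue. y \<noteq> x"
        using AE_not_in[of "{x}" lebesgue] by (simp add: null_sets_completionI)
      then show "AE y in lebesgue. (indicator {x..x + h} y *\<^sub>R f y) /\<^sub>R h
          = p y * (E y * of_real (indicator {x<..x + h} y / h))"
        by eventually_elim (auto simp: f_def indicator_def scaleR_conv_of_real field_simps)
    qed
    finally show ?thesis .
  qed
  \<comment> \<open>Lebesgue differentiation: the value at almost every point is the limit of the means over \<open>[x, x + h]\<close>.\<close>
  obtain N where N: "negligible N" and deriv: "\<And>x e. \<lbrakk>x \<notin> N; 0 < e\<rbrakk> \<Longrightarrow>
      \<exists>d>0. \<forall>h. 0 < h \<and> h < d \<longrightarrow> norm (integral (cbox x (x + h *\<^sub>R One)) f /\<^sub>R h - f x) < e"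
  proof (rule integrable_ccontinuous_explicit[of f], goal_cases)
    case (1 c d)
    show ?case using set_lebesgue_integral_eq_integral(1)[OF set_int, of c d] by simp
  next
    case (2 N)
    show ?case by (rule 2(1)[OF 2(2)]) (use 2(3) in simp)
  qed
  have pointwise: "cmod (p x) \<le> I x 0" if x: "x \<notin> N" for x
  proof -
    have "cmod (f x) \<le> exp (- Re \<mu> * x) * I x 0 + e" if e: "e > 0" for e
    proof -
      obtain d where d: "d > 0" and *: "\<And>h. 0 < h \<Longrightarrow> h < d \<Longrightarrow>
          norm (integral (cbox x (x + h *\<^sub>R One)) f /\<^sub>R h - f x) < e"
        using deriv[OF x e] by blast
      have "cmod (f x) \<le> exp (- Re \<mu> * x + \<bar>Re \<mu>\<bar> * h) * I x h + e" if h: "0 < h" "h < d" for h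
      proof -
        have "cmod (f x) \<le> cmod (integral (cbox x (x + h *\<^sub>R One)) f /\<^sub>R h) + e"
          using *[OF h] norm_triangle_sub[of "f x" "integral (cbox x (x + h *\<^sub>R One)) f /\<^sub>R h"]
          by (simp add: norm_minus_commute)
        then show ?thesis
          using weak_ode_average_bound[OF dir p F h(1) weak, of x]
          unfolding avg[OF h(1)] E_def I_def H_def by simp
      qed
      then have le: "cmod (f x) \<le> exp (- Re \<mu> * x + \<bar>Re \<mu>\<bar> * \<delta> n) * I x (\<delta> n) + e"
        if "\<delta> n < d" for n using \<delta> that by blast
      have "\<forall>\<^sub>F n in sequentially. \<delta> n < d"
        by (rule order_tendstoD(2)[OF lim_\<delta> d])
      then have "\<forall>\<^sub>F n in sequentially.
          cmod (f x) \<le> exp (- Re \<mu> * x + \<bar>Re \<mu>\<bar> * \<delta> n) * I x (\<delta> n) + e"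
        by (rule eventually_mono) (rule le)
      moreover have "(\<lambda>n. exp (- Re \<mu> * x + \<bar>Re \<mu>\<bar> * \<delta> n) * I x (\<delta> n) + e)
          \<longlonglongrightarrow> exp (- Re \<mu> * x + \<bar>Re \<mu>\<bar> * 0) * I x 0 + e"
        by (intro tendsto_intros lim_\<delta> lim_I)
      ultimately have "cmod (f x) \<le> exp (- Re \<mu> * x + \<bar>Re \<mu>\<bar> * 0) * I x 0 + e"
        by (intro tendsto_lowerbound[where F = sequentially]) auto
      then show ?thesis by simp
    qed
    then have "cmod (f x) \<le> exp (- Re \<mu> * x) * I x 0" by (rule field_le_epsilon)
    moreover have "cmod (f x) = exp (- Re \<mu> * x) * cmod (p x)"
      by (simp add: f_def E_def norm_mult)
    ultimately show ?thesis by simp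
  qed
  have "AE x in lebesgue. x \<notin> N"
    using N by (intro AE_not_in) (simp add: negligible_iff_null_sets)
  then show ?thesis
    by eventually_elim (use pointwise in \<open>simp add: I_def H_def cong: if_cong\<close>)
qed

section \<open>Elements of \<open>L\<^sup>2\<close> and of the completion through their representatives\<close>

lemma square_integrable_rep: "square_integrable (rep_L2 u)"
  using Quotient3_rep_reflp[OF Quotient3_L2, of u] by (simp add: L2_rel_def)

lemma rep_abs_L2: "square_integrable f \<Longrightarrow> AE x in lebesgue. rep_L2 (abs_L2 f) x = f x"
  using rep_abs_rsp_left[OF Quotient3_L2, of f f] by (simp add: L2_rel_def)

lemma L2_eqI:
  assumes "AE x in lebesgue. rep_L2 u x = rep_L2 v x" shows "u = v"
  using Quotient3_rel_rep[OF Quotient3_L2, of u v] assms square_integrable_rep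
  by (auto simp: L2_rel_def)

lemma rep_zero_L2: "AE x in lebesgue. rep_L2 0 x = 0"
  using rep_abs_L2[OF square_integrable_zero] by (simp add: zero_L2_def)

lemma rep_minus_L2: "AE x in lebesgue. rep_L2 (u - v) x = rep_L2 u x - rep_L2 v x"
  using rep_abs_L2[OF square_integrable_diff[OF square_integrable_rep square_integrable_rep]]
  by (simp add: minus_L2_def)

lemma rep_scale_L2: "AE x in lebesgue. rep_L2 (scale_L2 c u) x = c * rep_L2 u x"
  using rep_abs_L2[OF square_integrable_scale[OF square_integrable_rep]]
  by (simp add: scale_L2_def)

lemma rep_mult_L2:
  assumes "ess_bounded a"
  shows "AE x in lebesgue. rep_L2 (mult_L2 a u) x = a x * rep_L2 u x"
  using rep_abs_L2[OF square_integrable_mult[OF assms square_integrable_rep]] assms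
  by (simp add: mult_L2_def)

lemma Hdot1_rel_refl: "grad_Cauchy \<phi> \<Longrightarrow> Hdot1_rel \<phi> \<phi>"
  by (simp add: Hdot1_rel_def grad_norm_zero)

lemma abs_Hdot1_eq_iff:
  "grad_Cauchy \<phi> \<Longrightarrow> grad_Cauchy \<psi> \<Longrightarrow> abs_Hdot1 \<phi> = abs_Hdot1 \<psi> \<longleftrightarrow> Hdot1_rel \<phi> \<psi>"
  using Quotient3_rel[OF Quotient3_Hdot1, of \<phi> \<psi>] Hdot1_rel_refl by blast

lemma scale_abs_Hdot1:
  assumes "grad_Cauchy \<phi>"
  shows "scale_Hdot1 c (abs_Hdot1 \<phi>) = abs_Hdot1 (\<lambda>n x. c * \<phi> n x)"
  using scale_Hdot1.abs_eq Hdot1_rel_refl[OF assms] by (simp add: eq_onp_def)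

lemma zero_Hdot1_eq: "0 = abs_Hdot1 (\<lambda>n x. 0)"
  by (simp add: zero_Hdot1_def)

lemma L2_norm_cong_AE:
  assumes "square_integrable f" "square_integrable g" "AE x in lebesgue. f x = g x"
  shows "L2_norm f = L2_norm g"
proof -
  have "(LINT x|lebesgue. (cmod (f x))\<^sup>2) = (LINT x|lebesgue. (cmod (g x))\<^sup>2)"
    by (rule integral_cong_AE)
       (use assms in \<open>auto simp: square_integrable_def elim!: eventually_mono\<close>)
  then show ?thesis by (simp add: L2_norm_def)
qed

lemma L2_norm_eq_0_AE:
  assumes "square_integrable f" "L2_norm f = 0"
  shows "AE x in lebesgue. f x = 0"
proof -
  have "(LINT x|lebesgue. (cmod (f x))\<^sup>2) = 0"
    using assms(2) by (simp add: L2_norm_def)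
  then have "AE x in lebesgue. (cmod (f x))\<^sup>2 = 0"
    using assms(1) by (subst (asm) integral_nonneg_eq_0_iff_AE) (auto simp: square_integrable_def)
  then show ?thesis by eventually_elim simp
qed

lemma square_integrable_ddx: "grad_Cauchy \<phi> \<Longrightarrow> square_integrable (ddx (\<phi> n))"
  by (simp add: grad_Cauchy_def test_function_ddx_square_integrable)

lemma weak_derivative_test:
  "weak_derivative u v \<Longrightarrow> test_function \<phi> \<Longrightarrow>
    (LINT x|lebesgue. rep_L2 u x * ddx \<phi> x) = - (LINT x|lebesgue. rep_L2 v x * \<phi> x)"
  by (simp add: weak_derivative_def)

lemma gradient_eq_0:
  assumes "gradient \<psi> g" "AE x in lebesgue. rep_L2 g x = 0"
  shows "\<psi> = 0"
proof -
  obtain \<phi> where \<phi>: "grad_Cauchy \<phi>" "\<psi> = abs_Hdot1 \<phi>" and lim: "L2_tendsto (\<lambda>n. ddx (\<phi> n)) g"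
    using assms(1) by (auto simp: gradient_def)
  have "L2_norm (\<lambda>x. ddx (\<phi> n) x - rep_L2 g x) = grad_norm (\<phi> n)" for n
    unfolding grad_norm_def
    using assms(2) by (intro L2_norm_cong_AE square_integrable_diff square_integrable_rep
        square_integrable_ddx \<phi>(1)) (auto elim: eventually_mono)
  then have "Hdot1_rel \<phi> (\<lambda>n x. 0)"
    using lim \<phi>(1) by (simp add: L2_tendsto_def Hdot1_rel_def grad_Cauchy_zero)
  then show ?thesis
    using abs_Hdot1_eq_iff[OF \<phi>(1) grad_Cauchy_zero] \<phi>(2) by (simp add: zero_Hdot1_eq)
qed

text \<open>The first component of the eigenvalue equation: if \<open>c \<psi>\<close> is the image of \<open>u\<close> in the completion,
  then \<open>u\<close> has the weak derivative \<open>c\<close> times the gradient of \<open>\<psi>\<close>. Both gradients are limits of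
  derivatives of equivalent Cauchy sequences.\<close>

lemma gradient_scale_eq_H1_derivative:
  assumes "gradient \<psi> g" "H1_inclusion u (scale_Hdot1 c \<psi>)"
  obtains v where "weak_derivative u v" "AE x in lebesgue. rep_L2 v x = c * rep_L2 g x"
proof -
  obtain \<phi> where \<phi>: "grad_Cauchy \<phi>" "\<psi> = abs_Hdot1 \<phi>" and lim_\<phi>: "L2_tendsto (\<lambda>n. ddx (\<phi> n)) g"
    using assms(1) by (auto simp: gradient_def)
  obtain \<eta> v where \<eta>: "grad_Cauchy \<eta>" "scale_Hdot1 c \<psi> = abs_Hdot1 \<eta>"
    and v: "weak_derivative u v" and lim_\<eta>: "L2_tendsto (\<lambda>n. ddx (\<eta> n)) v"
    using assms(2) by (auto simp: H1_inclusion_def)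
  have test: "test_function (\<phi> n)" "test_function (\<eta> n)" "test_function (\<lambda>x. c * \<phi> n x)" for n
    using \<phi>(1) \<eta>(1) by (auto simp: grad_Cauchy_def test_function_scale)
  have "abs_Hdot1 \<eta> = abs_Hdot1 (\<lambda>n x. c * \<phi> n x)"
    using \<eta>(2) \<phi>(2) scale_abs_Hdot1[OF \<phi>(1)] by simp
  then have "Hdot1_rel \<eta> (\<lambda>n x. c * \<phi> n x)"
    by (rule abs_Hdot1_eq_iff[OF \<eta>(1) grad_Cauchy_scale[OF \<phi>(1)], THEN iffD1])
  then have "(\<lambda>n. grad_norm (\<lambda>x. \<eta> n x - c * \<phi> n x)) \<longlonglongrightarrow> 0"
    by (simp add: Hdot1_rel_def)
  then have lim: "(\<lambda>n. L2_norm (\<lambda>x. ddx (\<eta> n) x - c * ddx (\<phi> n) x)) \<longlonglongrightarrow> 0"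
    using test by (simp add: grad_norm_diff ddx_scale test_function_differentiable)
  let ?d = "\<lambda>x. rep_L2 v x - c * rep_L2 g x"
  note sq = square_integrable_rep square_integrable_ddx[OF \<phi>(1)] square_integrable_ddx[OF \<eta>(1)]
    square_integrable_diff square_integrable_scale
  have le: "L2_norm ?d \<le> 2 * L2_norm (\<lambda>x. ddx (\<eta> n) x - rep_L2 v x)
      + 2 * (2 * L2_norm (\<lambda>x. ddx (\<eta> n) x - c * ddx (\<phi> n) x)
        + 2 * (cmod c * L2_norm (\<lambda>x. ddx (\<phi> n) x - rep_L2 g x)))" for n
  proof -
    have "L2_norm ?d = L2_norm (\<lambda>x. (rep_L2 v x - ddx (\<eta> n) x) + (ddx (\<eta> n) x - c * rep_L2 g x))"
      by simp
    also have "\<dots> \<le> 2 * L2_norm (\<lambda>x. rep_L2 v x - ddx (\<eta> n) x)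
        + 2 * L2_norm (\<lambda>x. ddx (\<eta> n) x - c * rep_L2 g x)"
      by (rule L2_norm_add_le) (intro sq)+
    also have "L2_norm (\<lambda>x. ddx (\<eta> n) x - c * rep_L2 g x)
        = L2_norm (\<lambda>x. (ddx (\<eta> n) x - c * ddx (\<phi> n) x) + c * (ddx (\<phi> n) x - rep_L2 g x))"
      by (simp add: algebra_simps)
    also have "\<dots> \<le> 2 * L2_norm (\<lambda>x. ddx (\<eta> n) x - c * ddx (\<phi> n) x)
        + 2 * L2_norm (\<lambda>x. c * (ddx (\<phi> n) x - rep_L2 g x))"
      by (rule L2_norm_add_le) (intro sq)+
    finally show ?thesis
      by (simp add: L2_norm_scale L2_norm_minus_commute[of "rep_L2 v"])
  qed
  have "(\<lambda>n. 2 * L2_norm (\<lambda>x. ddx (\<eta> n) x - rep_L2 v x)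
      + 2 * (2 * L2_norm (\<lambda>x. ddx (\<eta> n) x - c * ddx (\<phi> n) x)
        + 2 * (cmod c * L2_norm (\<lambda>x. ddx (\<phi> n) x - rep_L2 g x))))
      \<longlonglongrightarrow> 2 * 0 + 2 * (2 * 0 + 2 * (cmod c * 0))"
    using lim lim_\<phi> lim_\<eta> unfolding L2_tendsto_def by (intro tendsto_intros)
  then have "L2_norm ?d \<le> 2 * 0 + 2 * (2 * 0 + 2 * (cmod c * 0))"
    by (rule tendsto_lowerbound) (use le in auto)
  then have "L2_norm ?d = 0" using L2_norm_nonneg[of ?d] by simp
  then have "AE x in lebesgue. ?d x = 0"
    by (intro L2_norm_eq_0_AE) (intro sq)
  then show ?thesis by (intro that[OF v]) (auto elim: eventually_mono)
qed

section \<open>Absence of eigenvalues\<close>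

text \<open>The functions \<open>g + \<sigma> u\<close> with \<open>\<sigma> = \<plusminus>1\<close> solve \<open>p' = \<sigma> \<mu> p + a u\<close>. They are bounded by
  integrals of \<open>\<bar>a u\<bar>\<close> over complementary half-lines, which is where the constant \<open>2\<close> comes from.\<close>

lemma first_order_system_trivial:
  fixes a u g :: "real \<Rightarrow> complex"
  assumes a: "ess_bounded a" "integrable lebesgue a" "(LINT x|lebesgue. cmod (a x)) < 2"
    and sq: "square_integrable u" "square_integrable g"
    and u': "\<And>\<phi>. test_function \<phi> \<Longrightarrow>
      (LINT x|lebesgue. u x * ddx \<phi> x) = - (LINT x|lebesgue. (\<mu> * g x) * \<phi> x)"
    and g': "\<And>\<phi>. test_function \<phi> \<Longrightarrow>
      (LINT x|lebesgue. g x * ddx \<phi> x) = - (LINT x|lebesgue. (\<mu> * u x + a x * u x) * \<phi> x)"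
  shows "AE x in lebesgue. u x = 0 \<and> g x = 0"
proof -
  define I where "I = (LINT x|lebesgue. cmod (a x * u x))"
  have int_au: "integrable lebesgue (\<lambda>x. a x * u x)"
    by (rule integrable_mult_square_integrable[OF a(1,2) sq(1)])
  have sq_au: "square_integrable (\<lambda>x. a x * u x)" by (rule square_integrable_mult[OF a(1) sq(1)])
  define half where "half right x = (LINT y|lebesgue. indicator (if right then {x..} else {..x}) y * cmod (a y * u y))"
    for right and x :: real
  have bound: "AE x in lebesgue. cmod (g x + \<sigma> * u x) \<le> half right x"
    if \<sigma>: "\<sigma> = 1 \<or> \<sigma> = -1" and dir: "if right then Re (\<sigma> * \<mu>) \<ge> 0 else Re (\<sigma> * \<mu>) \<le> 0" for \<sigma> right
    unfolding half_def
  proof (rule weak_ode_bound[OF dir _ int_au])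
    show "square_integrable (\<lambda>x. g x + \<sigma> * u x)"
      by (intro square_integrable_add square_integrable_scale sq)
    fix \<phi> assume \<phi>: "test_function \<phi>"
    note d = test_function_ddx_square_integrable[OF \<phi>] and t = test_function_square_integrable[OF \<phi>]
    have "(LINT x|lebesgue. (g x + \<sigma> * u x) * ddx \<phi> x)
        = (LINT x|lebesgue. g x * ddx \<phi> x + \<sigma> * (u x * ddx \<phi> x))"
      by (simp add: algebra_simps)
    also have "\<dots> = (LINT x|lebesgue. g x * ddx \<phi> x) + \<sigma> * (LINT x|lebesgue. u x * ddx \<phi> x)"
      by (subst Bochner_Integration.integral_add)
         (intro integrable_mult_right integrable_square_integrable_mult d sq | simp)+
    also have "\<dots> = - ((LINT x|lebesgue. (\<mu> * u x + a x * u x) * \<phi> x)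
        + \<sigma> * (LINT x|lebesgue. (\<mu> * g x) * \<phi> x))"
      by (simp add: u'[OF \<phi>] g'[OF \<phi>])
    also have "\<dots> = - (LINT x|lebesgue. (\<mu> * u x + a x * u x) * \<phi> x + \<sigma> * ((\<mu> * g x) * \<phi> x))"
      by (subst Bochner_Integration.integral_add)
         (intro integrable_mult_right integrable_square_integrable_mult t square_integrable_add
           square_integrable_scale sq sq_au | simp)+
    also have "(\<lambda>x. (\<mu> * u x + a x * u x) * \<phi> x + \<sigma> * ((\<mu> * g x) * \<phi> x))
        = (\<lambda>x. (\<sigma> * \<mu> * (g x + \<sigma> * u x) + a x * u x) * \<phi> x)"
      using \<sigma> by (auto simp: algebra_simps)
    finally show "(LINT x|lebesgue. (g x + \<sigma> * u x) * ddx \<phi> x)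
        = - (LINT x|lebesgue. (\<sigma> * \<mu> * (g x + \<sigma> * u x) + a x * u x) * \<phi> x)" .
  qed
  have half_add: "half True x + half False x = I" for x
  proof -
    have int_half: "integrable lebesgue (\<lambda>y. indicator S y * cmod (a y * u y))" if "S \<in> sets lebesgue" for S
      using integrable_mult_indicator[OF that integrable_norm[OF int_au]] by simp
    have "half True x + half False x = (LINT y|lebesgue. indicator {x..} y * cmod (a y * u y)
        + indicator {..x} y * cmod (a y * u y))"
      unfolding half_def by (subst Bochner_Integration.integral_add) (auto intro!: int_half)
    also have "\<dots> = I"
      unfolding I_def
    proof (rule integral_cong_AE)
      have m: "(\<lambda>y. cmod (a y * u y)) \<in> borel_measurable lebesgue"
        using integrable_norm[OF int_au] by (rule borel_measurable_integrable)
      show "(\<lambda>y. cmod (a y * u y)) \<in> borel_measurable lebesgue" by (rule m)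
      show "(\<lambda>y. indicator {x..} y * cmod (a y * u y) + indicator {..x} y * cmod (a y * u y))
          \<in> borel_measurable lebesgue"
        by (intro borel_measurable_add borel_measurable_times m borel_measurable_indicator) simp_all
      have "AE y in lebesgue. y \<noteq> x"
        using AE_not_in[of "{x}" lebesgue] by (simp add: null_sets_completionI)
      then show "AE y in lebesgue. indicator {x..} y * cmod (a y * u y)
          + indicator {..x} y * cmod (a y * u y) = cmod (a y * u y)"
        by eventually_elim (auto simp: indicator_def)
    qed
    finally show ?thesis .
  qed
  define right where "right = (Re \<mu> \<ge> 0)"
  have sum: "half right x + half (\<not> right) x = I" for x
    using half_add[of x] by (cases right) auto
  have ug: "AE x in lebesgue. cmod (u x) \<le> I / 2 \<and> cmod (g x) \<le> I / 2"
  proof -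
    have "AE x in lebesgue. cmod (g x + u x) \<le> half right x"
      using bound[of 1 right] by (simp add: right_def)
    moreover have "AE x in lebesgue. cmod (g x - u x) \<le> half (\<not> right) x"
      using bound[of "-1" "\<not> right"] by (simp add: right_def)
    ultimately show ?thesis
    proof eventually_elim
      case (elim x)
      have "cmod ((g x + u x) - (g x - u x)) \<le> I"
        using elim norm_triangle_ineq4[of "g x + u x" "g x - u x"] sum[of x] by linarith
      moreover have "cmod ((g x + u x) + (g x - u x)) \<le> I"
        using elim norm_triangle_ineq[of "g x + u x" "g x - u x"] sum[of x] by linarith
      moreover have "(g x + u x) - (g x - u x) = 2 * u x" "(g x + u x) + (g x - u x) = 2 * g x"
        by simp_all
      ultimately have "cmod (2 * u x) \<le> I" "cmod (2 * g x) \<le> I" by simp_all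
      then show ?case by (simp add: norm_mult)
    qed
  qed
  have "AE x in lebesgue. cmod (a x * u x) \<le> I / 2 * cmod (a x)"
    using ug
  proof eventually_elim
    case (elim x)
    then show ?case
      using mult_left_mono[of "cmod (u x)" "I / 2" "cmod (a x)"] by (simp add: norm_mult mult.commute)
  qed
  then have "(LINT x|lebesgue. cmod (a x * u x)) \<le> (LINT x|lebesgue. I / 2 * cmod (a x))"
    by (intro integral_mono_AE integrable_mult_right integrable_norm a(2) int_au)
  then have "I \<le> (LINT x|lebesgue. I / 2 * cmod (a x))" by (simp only: I_def)
  also have "\<dots> = I / 2 * (LINT x|lebesgue. cmod (a x))" by simp
  finally have *: "I \<le> I / 2 * (LINT x|lebesgue. cmod (a x))" .
  have "I \<le> 0"
  proof (rule ccontr)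
    assume "\<not> I \<le> 0"
    then have "I / 2 * (LINT x|lebesgue. cmod (a x)) < I / 2 * 2"
      by (intro mult_strict_left_mono a(3)) auto
    with * show False by simp
  qed
  show "AE x in lebesgue. u x = 0 \<and> g x = 0"
    using ug
  proof eventually_elim
    case (elim x)
    moreover have "I / 2 \<le> 0" using \<open>I \<le> 0\<close> by simp
    ultimately have "cmod (u x) \<le> 0" "cmod (g x) \<le> 0" by (blast intro: order.trans)+
    then show ?case by simp
  qed
qed

theorem point_spectrum_empty:
  assumes a: "ess_bounded a" "integrable lebesgue a" "(LINT x|lebesgue. cmod (a x)) < 2"
  shows "point_spectrum (damped_wave_operator a) = {}"
proof (rule ccontr)
  assume "point_spectrum (damped_wave_operator a) \<noteq> {}"
  then obtain \<mu> \<psi> u where nz: "(\<psi>, u) \<noteq> 0"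
    and "((\<psi>, u), scale_energy \<mu> (\<psi>, u)) \<in> damped_wave_operator a"
    by (auto simp: point_spectrum_def)
  then obtain h where lap: "laplacian \<psi> h" and incl: "H1_inclusion u (scale_Hdot1 \<mu> \<psi>)"
    and h: "scale_L2 \<mu> u = h - mult_L2 a u"
    by (auto simp: damped_wave_operator_def)
  obtain g where grad: "gradient \<psi> g" and g': "weak_derivative g h"
    using lap by (auto simp: laplacian_def)
  obtain v where v: "weak_derivative u v" and v_eq: "AE x in lebesgue. rep_L2 v x = \<mu> * rep_L2 g x"
    using gradient_scale_eq_H1_derivative[OF grad incl] by blast
  have h_eq: "AE x in lebesgue. rep_L2 h x = \<mu> * rep_L2 u x + a x * rep_L2 u x"
    using rep_scale_L2[of \<mu> u] rep_minus_L2[of h "mult_L2 a u"] rep_mult_L2[OF a(1), of u]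
    unfolding h by eventually_elim (simp add: algebra_simps)
  have cong: "(LINT x|lebesgue. f x * \<phi> x) = (LINT x|lebesgue. f' x * \<phi> x)"
    if "AE x in lebesgue. f x = f' x" "f \<in> borel_measurable lebesgue" "f' \<in> borel_measurable lebesgue"
      "test_function \<phi>" for f f' \<phi> :: "real \<Rightarrow> complex"
    using that test_function_measurable
    by (intro integral_cong_AE borel_measurable_times) (auto elim: eventually_mono)
  note m = square_integrable_rep[unfolded square_integrable_def, THEN conjunct1]
  have am: "a \<in> borel_measurable lebesgue" using a(2) by (rule borel_measurable_integrable)
  have *: "AE x in lebesgue. rep_L2 u x = 0 \<and> rep_L2 g x = 0"
  proof (rule first_order_system_trivial[OF a square_integrable_rep square_integrable_rep])
    fix \<phi> :: "real \<Rightarrow> complex" assume \<phi>: "test_function \<phi>"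
    have "(LINT x|lebesgue. rep_L2 v x * \<phi> x) = (LINT x|lebesgue. (\<mu> * rep_L2 g x) * \<phi> x)"
      by (rule cong[OF v_eq _ _ \<phi>]) (intro borel_measurable_times borel_measurable_const m)+
    then show "(LINT x|lebesgue. rep_L2 u x * ddx \<phi> x) = - (LINT x|lebesgue. (\<mu> * rep_L2 g x) * \<phi> x)"
      using weak_derivative_test[OF v \<phi>] by simp
    have "(LINT x|lebesgue. rep_L2 h x * \<phi> x)
        = (LINT x|lebesgue. (\<mu> * rep_L2 u x + a x * rep_L2 u x) * \<phi> x)"
      by (rule cong[OF h_eq _ _ \<phi>])
         (intro borel_measurable_add borel_measurable_times borel_measurable_const m am)+
    then show "(LINT x|lebesgue. rep_L2 g x * ddx \<phi> x)
        = - (LINT x|lebesgue. (\<mu> * rep_L2 u x + a x * rep_L2 u x) * \<phi> x)"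
      using weak_derivative_test[OF g' \<phi>] by simp
  qed
  have "\<psi> = 0" by (rule gradient_eq_0[OF grad]) (use * in auto)
  moreover have "u = 0"
    using * rep_zero_L2 by (intro L2_eqI) (auto elim: eventually_elim2)
  ultimately show False using nz by (simp add: zero_prod_def)
qed

section \<open>Smooth functions as elements of the Sobolev spaces\<close>

lemma test_function_ddx:
  assumes "test_function \<phi>" shows "test_function (ddx \<phi>)"
proof -
  let ?K = "closure {x. \<phi> x \<noteq> 0}"
  have K: "compact ?K" using assms by (simp add: test_function_iff)
  have "ddx \<phi> x = 0" if "x \<notin> ?K" for x
  proof -
    have "(\<phi> has_vector_derivative 0) (at x)"
    proof (rule has_vector_derivative_transform_within_open)
      show "((\<lambda>x. 0) has_vector_derivative 0) (at x)" by simp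
      show "open (- ?K)" "x \<in> - ?K" using that by auto
      show "0 = \<phi> y" if "y \<in> - ?K" for y
        using that closure_subset[of "{x. \<phi> x \<noteq> 0}"] by auto
    qed
    then show ?thesis by (simp add: ddx_def vector_derivative_at)
  qed
  then have "bounded {x. ddx \<phi> x \<noteq> 0}"
    by (intro bounded_subset[OF compact_imp_bounded[OF K]]) blast
  then show ?thesis
    using assms smooth_ddx by (simp add: test_function_iff)
qed

lemma LINT_ddx_test_function:
  assumes "test_function \<Phi>" shows "(LINT x|lebesgue. ddx \<Phi> x) = 0"
proof -
  obtain B C where B: "\<And>x. cmod (\<Phi> x) \<le> C * indicator {-B..B} x"
    using test_function_bound[OF assms] by blast
  obtain B' C' where B': "\<And>x. cmod (ddx \<Phi> x) \<le> C' * indicator {-B'..B'} x"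
    using test_function_bound[OF test_function_ddx[OF assms]] by blast
  define R where "R = \<bar>B\<bar> + \<bar>B'\<bar> + 1"
  have out: "\<Phi> R = 0" "\<Phi> (- R) = 0"
  proof -
    have "R \<notin> {-B..B}" "- R \<notin> {-B..B}" by (auto simp: R_def)
    then show "\<Phi> R = 0" "\<Phi> (- R) = 0" using B[of R] B[of "- R"] by simp_all
  qed
  have eq: "indicator {-R..R} x *\<^sub>R ddx \<Phi> x = ddx \<Phi> x" for x
  proof (cases "x \<in> {-R..R}")
    case False
    then have "x \<notin> {-B'..B'}" by (auto simp: R_def)
    with False B'[of x] show ?thesis by simp
  qed simp
  have sm: "smooth \<Phi>" using assms by (simp add: test_function_iff)
  have "integrable lebesgue (\<lambda>x. ddx \<Phi> x)"
  proof (rule Bochner_Integration.integrable_bound)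
    show "integrable lebesgue (\<lambda>x. C' * indicator {-B'..B'} x)"
      by (intro integrable_mult_right integrable_indicator_Icc)
    show "ddx \<Phi> \<in> borel_measurable lebesgue"
      by (intro smooth_measurable smooth_ddx sm)
    show "AE x in lebesgue. norm (ddx \<Phi> x) \<le> norm (C' * indicator {-B'..B'} x)"
      using order.trans[OF B' abs_ge_self] by (intro AE_I2) (simp only: real_norm_def)
  qed
  then have "set_integrable lebesgue {-R..R} (ddx \<Phi>)"
    by (simp add: set_integrable_def eq)
  from set_lebesgue_integral_eq_integral(2)[OF this]
  have "(LINT x|lebesgue. ddx \<Phi> x) = integral {-R..R} (ddx \<Phi>)"
    by (simp add: set_lebesgue_integral_def eq)
  also have "\<dots> = \<Phi> R - \<Phi> (- R)"
  proof (rule integral_unique, rule fundamental_theorem_of_calculus)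
    show "(\<Phi> has_vector_derivative ddx \<Phi> x) (at x within {-R..R})" for x
      by (rule has_vector_derivative_at_within[OF smooth_has_vector_derivative[OF sm]])
  qed (simp add: R_def)
  finally show ?thesis using out by simp
qed

lemma test_function_smooth_mult:
  assumes "smooth f" "test_function \<phi>" shows "test_function (\<lambda>x. f x * \<phi> x)"
proof -
  have "bounded {x. f x * \<phi> x \<noteq> 0}"
    by (rule bounded_subset[of "{x. \<phi> x \<noteq> 0}"]) (use assms in \<open>auto simp: test_function_iff\<close>)
  then show ?thesis using assms by (simp add: test_function_iff smooth_mult)
qed

lemma weak_derivative_smooth:
  assumes f: "smooth f" "square_integrable f" "square_integrable (ddx f)"
  shows "weak_derivative (abs_L2 f) (abs_L2 (ddx f))"
  unfolding weak_derivative_def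
proof (intro allI impI)
  fix \<phi> assume \<phi>: "test_function \<phi>"
  have s\<phi>: "smooth \<phi>" using \<phi> by (simp add: test_function_iff)
  have cong: "(LINT x|lebesgue. rep_L2 (abs_L2 g) x * \<psi> x) = (LINT x|lebesgue. g x * \<psi> x)"
    if "square_integrable g" "\<psi> \<in> borel_measurable lebesgue" for g \<psi>
    using that square_integrable_rep[of "abs_L2 g"]
    by (intro integral_cong_AE borel_measurable_times)
       (auto simp: square_integrable_def intro: eventually_mono[OF rep_abs_L2[OF that(1)]])
  have "0 = (LINT x|lebesgue. f x * ddx \<phi> x + ddx f x * \<phi> x)"
    using LINT_ddx_test_function[OF test_function_smooth_mult[OF f(1) \<phi>]]
    by (simp add: ddx_mult[OF f(1) s\<phi>])
  also have "\<dots> = (LINT x|lebesgue. f x * ddx \<phi> x) + (LINT x|lebesgue. ddx f x * \<phi> x)"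
    by (intro Bochner_Integration.integral_add integrable_square_integrable_mult f
        test_function_square_integrable test_function_ddx \<phi>)
  finally have "(LINT x|lebesgue. f x * ddx \<phi> x) = - (LINT x|lebesgue. ddx f x * \<phi> x)"
    by (simp add: eq_neg_iff_add_eq_0)
  then show "(LINT x|lebesgue. rep_L2 (abs_L2 f) x * ddx \<phi> x)
      = - (LINT x|lebesgue. rep_L2 (abs_L2 (ddx f)) x * \<phi> x)"
    by (simp add: cong f test_function_measurable test_function_ddx \<phi>)
qed

lemma L2_tendsto_abs:
  assumes "\<And>n. square_integrable (\<phi> n)" "square_integrable f"
    and "(\<lambda>n. L2_norm (\<lambda>x. \<phi> n x - f x)) \<longlonglongrightarrow> 0"
  shows "L2_tendsto \<phi> (abs_L2 f)"
proof -
  have "L2_norm (\<lambda>x. \<phi> n x - rep_L2 (abs_L2 f) x) = L2_norm (\<lambda>x. \<phi> n x - f x)" for n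
    by (intro L2_norm_cong_AE square_integrable_diff square_integrable_rep assms)
       (auto intro: eventually_mono[OF rep_abs_L2[OF assms(2)]])
  then show ?thesis using assms(3) by (simp add: L2_tendsto_def)
qed

lemma L2_norm_dominated_tendsto_0:
  assumes "\<And>n. g n \<in> borel_measurable lebesgue" "integrable lebesgue w"
    and "\<And>n x. (cmod (g n x))\<^sup>2 \<le> w x" "\<And>x. (\<lambda>n. g n x) \<longlonglongrightarrow> 0"
  shows "(\<lambda>n. L2_norm (g n)) \<longlonglongrightarrow> 0"
proof -
  have "(\<lambda>n. LINT x|lebesgue. (cmod (g n x))\<^sup>2) \<longlonglongrightarrow> integral\<^sup>L lebesgue (\<lambda>x::real. 0::real)"
  proof (rule integral_dominated_convergence)
    show "integrable lebesgue w" by (rule assms)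
    show "(\<lambda>x. (cmod (g n x))\<^sup>2) \<in> borel_measurable lebesgue" for n
      by (intro borel_measurable_power measurable_compose[OF assms(1) borel_measurable_norm])
    have "(\<lambda>n. (cmod (g n x))\<^sup>2) \<longlonglongrightarrow> (cmod 0)\<^sup>2" for x
      by (intro tendsto_intros assms(4))
    then show "AE x in lebesgue. (\<lambda>n. (cmod (g n x))\<^sup>2) \<longlonglongrightarrow> 0" by simp
  qed (use assms(3) in auto)
  then have "(\<lambda>n. sqrt (LINT x|lebesgue. (cmod (g n x))\<^sup>2)) \<longlonglongrightarrow> sqrt 0"
    by (intro tendsto_real_sqrt) simp
  then show ?thesis by (simp add: L2_norm_def)
qed

text \<open>Multiplication by smooth cut-offs of the intervals \<open>[-n, n]\<close> approximates a smooth square-integrable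
  function with square-integrable derivative in \<open>L\<^sup>2\<close>, together with its derivative.\<close>

lemma test_functions_approximate_smooth:
  assumes f: "smooth f" "square_integrable f" "square_integrable (ddx f)"
  obtains \<phi> where "\<And>n::nat. test_function (\<phi> n)" "(\<lambda>n. L2_norm (\<lambda>x. \<phi> n x - f x)) \<longlonglongrightarrow> 0"
    "(\<lambda>n. L2_norm (\<lambda>x. ddx (\<phi> n) x - ddx f x)) \<longlonglongrightarrow> 0"
proof -
  obtain J J' :: "real \<Rightarrow> real" and C
    where J: "\<And>x. (J has_real_derivative J' x) (at x)" and sJ: "smooth (\<lambda>x. of_real (J x))"
    and J0: "\<And>x. x \<le> 0 \<Longrightarrow> J x = 0" and J1: "\<And>x. x \<ge> 1 \<Longrightarrow> J x = 1"
    and J_bounds: "\<And>x. 0 \<le> J x" "\<And>x. J x \<le> 1"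
    and J'_bounds: "\<And>x. 0 \<le> J' x" "\<And>x. J' x \<le> C" and J'0: "\<And>x. x \<le> 0 \<or> x \<ge> 1 \<Longrightarrow> J' x = 0"
  proof (rule smooth_step_exists, goal_cases)
    case (1 J J' C)
    show ?case by (rule 1(1)[OF 1(2-10)])
  qed
  define \<kappa> where "\<kappa> n x = J (x + (real n + 1)) - J (x + (- real n))" for n x
  define \<kappa>' where "\<kappa>' n x = J' (x + (real n + 1)) - J' (x + (- real n))" for n x
  have \<kappa>: "(\<kappa> n has_real_derivative \<kappa>' n x) (at x)" for n x
    unfolding \<kappa>_def \<kappa>'_def by (auto intro!: derivative_eq_intros DERIV_chain'[OF _ J])
  have s\<kappa>: "smooth (\<lambda>x. of_real (\<kappa> n x))" for n
    using smooth_diff[OF smooth_affine[OF sJ, of 1 "real n + 1"] smooth_affine[OF sJ, of 1 "- real n"]]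
    by (simp add: \<kappa>_def)
  have ddx_\<kappa>: "ddx (\<lambda>x. of_real (\<kappa> n x)) = (\<lambda>x. of_real (\<kappa>' n x))" for n
    by (intro ddx_eqI has_vector_derivative_of_real_comp \<kappa>)
  have \<kappa>_le: "\<bar>\<kappa> n x - 1\<bar> \<le> 2" and \<kappa>'_le: "\<bar>\<kappa>' n x\<bar> \<le> C" for n x
    using J_bounds[of "x + (real n + 1)"] J_bounds[of "x + (- real n)"]
      J'_bounds[of "x + (real n + 1)"] J'_bounds[of "x + (- real n)"]
    by (auto simp: \<kappa>_def \<kappa>'_def)
  have one: "\<kappa> n x = 1 \<and> \<kappa>' n x = 0" if "\<bar>x\<bar> \<le> real n" for n x
    using that J0[of "x + (- real n)"] J1[of "x + (real n + 1)"]
      J'0[of "x + (- real n)"] J'0[of "x + (real n + 1)"]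
    by (simp add: \<kappa>_def \<kappa>'_def abs_le_iff)
  have zero: "\<kappa> n x = 0" if "\<bar>x\<bar> > real n + 1" for n x
    using that by (cases "x > 0") (simp_all add: \<kappa>_def J0 J1)
  define \<phi> where "\<phi> n x = of_real (\<kappa> n x) * f x" for n x
  have s\<phi>: "smooth (\<phi> n)" for n
    unfolding \<phi>_def by (intro smooth_mult s\<kappa> f)
  have test: "test_function (\<phi> n)" for n
  proof -
    have "{x. \<phi> n x \<noteq> 0} \<subseteq> {- (real n + 1)..real n + 1}"
      using zero[where n = n] by (force simp: \<phi>_def)
    then have "bounded {x. \<phi> n x \<noteq> 0}" by (rule bounded_subset[rotated]) simp
    then show ?thesis using s\<phi> by (simp add: test_function_iff)
  qed
  have ddx_\<phi>: "ddx (\<phi> n) x - ddx f x = of_real (\<kappa> n x - 1) * ddx f x + of_real (\<kappa>' n x) * f x" for n x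
    unfolding \<phi>_def ddx_mult[OF s\<kappa> f(1)] ddx_\<kappa> by (simp add: algebra_simps)
  have ev: "\<forall>\<^sub>F n in sequentially. \<kappa> n x = 1 \<and> \<kappa>' n x = 0" for x
  proof -
    have "\<forall>\<^sub>F n in sequentially. \<bar>x\<bar> \<le> real n"
      using filterlim_real_sequentially by (simp add: filterlim_at_top)
    then show ?thesis by (rule eventually_mono) (rule one)
  qed
  show ?thesis
  proof (rule that[OF test])
    have f2: "integrable lebesgue (\<lambda>x. (cmod (f x))\<^sup>2)" "integrable lebesgue (\<lambda>x. (cmod (ddx f x))\<^sup>2)"
      using f by (auto simp: square_integrable_def)
    show "(\<lambda>n. L2_norm (\<lambda>x. \<phi> n x - f x)) \<longlonglongrightarrow> 0"
    proof (rule L2_norm_dominated_tendsto_0)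
      show "(\<lambda>x. \<phi> n x - f x) \<in> borel_measurable lebesgue" for n
        by (intro smooth_measurable smooth_diff s\<phi> f)
      show "integrable lebesgue (\<lambda>x. 4 * (cmod (f x))\<^sup>2)"
        by (intro integrable_mult_right f2)
      show "(cmod (\<phi> n x - f x))\<^sup>2 \<le> 4 * (cmod (f x))\<^sup>2" for n x
      proof -
        have "\<phi> n x - f x = of_real (\<kappa> n x - 1) * f x" by (simp add: \<phi>_def algebra_simps)
        then have "cmod (\<phi> n x - f x) \<le> 2 * cmod (f x)"
          using \<kappa>_le[of n x] by (simp only: norm_mult norm_of_real mult_right_mono norm_ge_zero)
        from power_mono[OF this norm_ge_zero, of 2] show ?thesis by (simp add: power_mult_distrib)
      qed
      show "(\<lambda>n. \<phi> n x - f x) \<longlonglongrightarrow> 0" for x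
        by (rule tendsto_eventually[OF eventually_mono[OF ev[of x]]]) (simp add: \<phi>_def)
    qed
    show "(\<lambda>n. L2_norm (\<lambda>x. ddx (\<phi> n) x - ddx f x)) \<longlonglongrightarrow> 0"
    proof (rule L2_norm_dominated_tendsto_0)
      show "(\<lambda>x. ddx (\<phi> n) x - ddx f x) \<in> borel_measurable lebesgue" for n
        by (intro smooth_measurable smooth_diff smooth_ddx s\<phi> f)
      show "integrable lebesgue (\<lambda>x. 2 * (4 * (cmod (ddx f x))\<^sup>2) + 2 * (C\<^sup>2 * (cmod (f x))\<^sup>2))"
        by (intro Bochner_Integration.integrable_add integrable_mult_right f2)
      show "(cmod (ddx (\<phi> n) x - ddx f x))\<^sup>2
          \<le> 2 * (4 * (cmod (ddx f x))\<^sup>2) + 2 * (C\<^sup>2 * (cmod (f x))\<^sup>2)" for n x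
      proof -
        have "(\<kappa> n x - 1)\<^sup>2 \<le> 4"
          using power_mono[OF \<kappa>_le[of n x] abs_ge_zero, of 2] by simp
        moreover have "(\<kappa>' n x)\<^sup>2 \<le> C\<^sup>2"
          using power_mono[OF \<kappa>'_le[of n x] abs_ge_zero, of 2] by simp
        ultimately have "2 * ((\<kappa> n x - 1)\<^sup>2 * (cmod (ddx f x))\<^sup>2) + 2 * ((\<kappa>' n x)\<^sup>2 * (cmod (f x))\<^sup>2)
            \<le> 2 * (4 * (cmod (ddx f x))\<^sup>2) + 2 * (C\<^sup>2 * (cmod (f x))\<^sup>2)"
          by (intro add_mono mult_left_mono mult_right_mono) auto
        moreover have "(cmod (of_real (\<kappa> n x - 1) * ddx f x))\<^sup>2 = (\<kappa> n x - 1)\<^sup>2 * (cmod (ddx f x))\<^sup>2"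
          "(cmod (of_real (\<kappa>' n x) * f x))\<^sup>2 = (\<kappa>' n x)\<^sup>2 * (cmod (f x))\<^sup>2"
          by (simp_all only: norm_mult norm_of_real power_mult_distrib power2_abs)
        ultimately show ?thesis
          unfolding ddx_\<phi>
          using sq_norm_add_le[of "of_real (\<kappa> n x - 1) * ddx f x" "of_real (\<kappa>' n x) * f x"] by linarith
      qed
      show "(\<lambda>n. ddx (\<phi> n) x - ddx f x) \<longlonglongrightarrow> 0" for x
        by (rule tendsto_eventually[OF eventually_mono[OF ev[of x]]]) (simp add: ddx_\<phi>)
    qed
  qed
qed

lemma grad_Cauchy_if_L2_convergent:
  assumes test: "\<And>n. test_function (\<phi> n)" and g: "square_integrable g"
    and lim: "(\<lambda>n. L2_norm (\<lambda>x. ddx (\<phi> n) x - g x)) \<longlonglongrightarrow> 0"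
  shows "grad_Cauchy \<phi>"
  unfolding grad_Cauchy_def
proof (intro conjI allI impI test)
  fix e :: real assume "e > 0"
  then have "e / 4 > 0" by simp
  then have "\<forall>\<^sub>F n in sequentially. L2_norm (\<lambda>x. ddx (\<phi> n) x - g x) < e / 4"
    by (rule order_tendstoD(2)[OF lim])
  then obtain N where N: "\<And>n. n \<ge> N \<Longrightarrow> L2_norm (\<lambda>x. ddx (\<phi> n) x - g x) < e / 4"
    by (auto simp: eventually_sequentially)
  have "grad_norm (\<lambda>x. \<phi> m x - \<phi> n x) < e" if "m \<ge> N" "n \<ge> N" for m n
  proof -
    have "grad_norm (\<lambda>x. \<phi> m x - \<phi> n x)
        = L2_norm (\<lambda>x. (ddx (\<phi> m) x - g x) + (g x - ddx (\<phi> n) x))"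
      by (simp add: grad_norm_diff test)
    also have "\<dots> \<le> 2 * L2_norm (\<lambda>x. ddx (\<phi> m) x - g x) + 2 * L2_norm (\<lambda>x. g x - ddx (\<phi> n) x)"
      by (intro L2_norm_add_le square_integrable_diff test_function_ddx_square_integrable test g)
    also have "\<dots> < e"
      using N[OF that(1)] N[OF that(2)] by (simp add: L2_norm_minus_commute[of g])
    finally show ?thesis .
  qed
  then show "\<exists>N. \<forall>m\<ge>N. \<forall>n\<ge>N. grad_norm (\<lambda>x. \<phi> m x - \<phi> n x) < e" by blast
qed

section \<open>An explicit eigenfunction\<close>

text \<open>The functions \<open>P (tanh x) cosh(x)\<^sup>-\<^sup>m\<close> with a polynomial \<open>P\<close> form a set closed under
  differentiation that contains the eigenfunction, for \<open>P = 1\<close>.\<close>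

definition sech_poly :: "real \<Rightarrow> real poly \<Rightarrow> real \<Rightarrow> real" where
  "sech_poly m P x = poly P (tanh x) * cosh x powr (- m)"

lemma sech_poly_has_derivative:
  "(sech_poly m P has_real_derivative
    sech_poly m (pderiv P * [:1, 0, -1:] - [:0, m:] * P) x) (at x)"
proof -
  have d1: "((\<lambda>x. cosh x powr (- m)) has_real_derivative - m * tanh x * cosh x powr (- m)) (at x)"
    using cosh_real_pos[of x]
    by (auto intro!: derivative_eq_intros simp: powr_diff tanh_def field_simps powr_minus)
  have d2: "((\<lambda>x. poly P (tanh x)) has_real_derivative
      poly (pderiv P) (tanh x) * (1 - tanh x ^ 2)) (at x)"
    using cosh_real_pos[of x]
    by (intro DERIV_chain2[OF poly_DERIV]) (auto intro!: derivative_eq_intros)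
  from DERIV_mult[OF d2 d1] show ?thesis
    by (simp add: sech_poly_def[abs_def] algebra_simps power2_eq_square)
qed

lemma has_vector_derivative_sech_poly:
  "((\<lambda>x. complex_of_real (sech_poly m P x)) has_vector_derivative
    of_real (sech_poly m (pderiv P * [:1, 0, -1:] - [:0, m:] * P) x)) (at x)"
  by (rule has_vector_derivative_of_real_comp[OF sech_poly_has_derivative])

lemma smooth_sech_poly: "smooth (\<lambda>x. of_real (sech_poly m P x))"
proof (rule smooth_coinduct[of _ "range (\<lambda>P x. of_real (sech_poly m P x))"])
  fix f assume "f \<in> range (\<lambda>P x. complex_of_real (sech_poly m P x))"
  then show "\<exists>f'\<in>range (\<lambda>P x. complex_of_real (sech_poly m P x)).
      \<forall>x. (f has_vector_derivative f' x) (at x)"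
    by (auto intro!: has_vector_derivative_sech_poly)
qed blast

lemma FTC_UNIV_nonneg:
  fixes f F :: "real \<Rightarrow> real"
  assumes F: "\<And>x. (F has_real_derivative f x) (at x)" and f: "continuous_on UNIV f" "\<And>x. 0 \<le> f x"
    and lim: "(F \<longlongrightarrow> A) at_bot" "(F \<longlongrightarrow> B) at_top"
  shows "integrable lebesgue f" "(LINT x|lebesgue. f x) = B - A"
proof -
  have lim': "((F \<circ> real_of_ereal) \<longlongrightarrow> A) (at_right (-\<infinity>))" "((F \<circ> real_of_ereal) \<longlongrightarrow> B) (at_left \<infinity>)"
    using lim by (simp_all add: ereal_tendsto_simps)
  have cont: "isCont f x" for x using f(1) by (simp add: continuous_on_eq_continuous_at)
  note * = interval_integral_FTC_nonneg[of "-\<infinity>" "\<infinity>" F f, OF _ F cont _ lim']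
  have m: "f \<in> lborel \<rightarrow>\<^sub>M borel" using borel_measurable_continuous_onI[OF f(1)] by simp
  have "integrable lborel f"
    using *(1) f(2) by (simp add: set_integrable_def)
  then show "integrable lebesgue f"
    using integrable_completion[OF m] by simp
  have "(LBINT x. f x) = B - A"
    using *(2) f(2) by (simp add: interval_lebesgue_integral_def set_lebesgue_integral_def)
  then show "(LINT x|lebesgue. f x) = B - A"
    using integral_completion[OF m] by simp
qed

lemma integrable_inverse_1_plus_square: "integrable lebesgue (\<lambda>x::real. 1 / (1 + x\<^sup>2))"
proof (rule FTC_UNIV_nonneg(1))
  show "(arctan has_real_derivative 1 / (1 + x\<^sup>2)) (at x)" for x
    by (auto intro!: derivative_eq_intros simp: inverse_eq_divide)
  show "continuous_on UNIV (\<lambda>x::real. 1 / (1 + x\<^sup>2))"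
    by (intro continuous_intros) (auto simp: add_nonneg_eq_0_iff)
qed (auto intro: tendsto_arctan_at_bot tendsto_arctan_at_top)

text \<open>Exponential decay is weakened to the decay of \<open>1 / (1 + x\<^sup>2)\<close>, whose primitive is the arctangent.\<close>

lemma cosh_powr_le:
  fixes m x :: real assumes m: "m > 0"
  shows "(cosh x powr (- m))\<^sup>2 \<le> 2 powr (2 * m) / min 1 (2 * m\<^sup>2) * (1 / (1 + x\<^sup>2))"
proof -
  have pos: "min 1 (2 * m\<^sup>2) > 0" using m by simp
  have "exp \<bar>x\<bar> / 2 \<le> cosh x"
    by (cases "x \<ge> 0") (simp_all add: cosh_def)
  then have "cosh x powr (- (2 * m)) \<le> (exp \<bar>x\<bar> / 2) powr (- (2 * m))"
    using m by (intro powr_mono2') auto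
  also have "\<dots> = 2 powr (2 * m) / exp (2 * m * \<bar>x\<bar>)"
    by (simp add: powr_divide powr_minus exp_powr_real divide_simps mult_ac)
  also have "\<dots> \<le> 2 powr (2 * m) / (min 1 (2 * m\<^sup>2) * (1 + x\<^sup>2))"
  proof (rule divide_left_mono)
    have "min 1 (2 * m\<^sup>2) * (1 + x\<^sup>2) \<le> 1 + 2 * m\<^sup>2 * x\<^sup>2"
      unfolding distrib_left by (intro add_mono mult_right_mono) auto
    also have "\<dots> \<le> 1 + 2 * m * \<bar>x\<bar> + (2 * m * \<bar>x\<bar>)\<^sup>2 / 2"
      using m by (simp add: power_mult_distrib)
    also have "\<dots> \<le> exp (2 * m * \<bar>x\<bar>)"
      using m by (intro exp_lower_Taylor_quadratic) simp
    finally show "min 1 (2 * m\<^sup>2) * (1 + x\<^sup>2) \<le> exp (2 * m * \<bar>x\<bar>)" .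
    show "0 < exp (2 * m * \<bar>x\<bar>) * (min 1 (2 * m\<^sup>2) * (1 + x\<^sup>2))"
      using pos by (intro mult_pos_pos) (auto intro: add_pos_nonneg)
  qed simp
  finally show ?thesis
    by (simp add: power2_eq_square powr_add[symmetric])
qed

lemma square_integrable_sech_poly:
  assumes m: "m > 0" shows "square_integrable (\<lambda>x. of_real (sech_poly m P x))"
proof -
  obtain C where C: "\<And>t. t \<in> {-1..1} \<Longrightarrow> \<bar>poly P t\<bar> \<le> C"
    using compact_imp_bounded[OF compact_continuous_image[OF continuous_on_poly[OF continuous_on_id] compact_Icc[of "-1" "1::real"]], of P]
    unfolding bounded_iff real_norm_def by blast
  let ?K = "2 powr (2 * m) / min 1 (2 * m\<^sup>2)"
  have meas: "(\<lambda>x. complex_of_real (sech_poly m P x)) \<in> borel_measurable lebesgue"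
    by (rule smooth_measurable[OF smooth_sech_poly])
  have "integrable lebesgue (\<lambda>x. (cmod (complex_of_real (sech_poly m P x)))\<^sup>2)"
  proof (rule Bochner_Integration.integrable_bound)
    show "integrable lebesgue (\<lambda>x. C\<^sup>2 * (?K * (1 / (1 + x\<^sup>2))))"
      by (intro integrable_mult_right integrable_inverse_1_plus_square)
    show "(\<lambda>x. (cmod (complex_of_real (sech_poly m P x)))\<^sup>2) \<in> borel_measurable lebesgue"
      by (intro borel_measurable_power measurable_compose[OF meas borel_measurable_norm])
    have "(cmod (complex_of_real (sech_poly m P x)))\<^sup>2 \<le> C\<^sup>2 * (?K * (1 / (1 + x\<^sup>2)))" for x
    proof -
      have "\<bar>poly P (tanh x)\<bar>\<^sup>2 \<le> C\<^sup>2"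
        using tanh_real_lt_1[of x] tanh_real_gt_neg1[of x] by (intro power_mono C) auto
      then have "(poly P (tanh x))\<^sup>2 * (cosh x powr (- m))\<^sup>2 \<le> C\<^sup>2 * (?K * (1 / (1 + x\<^sup>2)))"
        by (intro mult_mono cosh_powr_le m) auto
      then show ?thesis by (simp only: sech_poly_def norm_of_real power2_abs power_mult_distrib)
    qed
    then show "AE x in lebesgue. norm ((cmod (complex_of_real (sech_poly m P x)))\<^sup>2)
        \<le> norm (C\<^sup>2 * (?K * (1 / (1 + x\<^sup>2))))"
      by (intro AE_I2) (metis abs_ge_self abs_of_nonneg order.trans real_norm_def zero_le_power2)
  qed
  with meas show ?thesis by (simp add: square_integrable_def)
qed

text \<open>The damping \<open>((cosh\<^sup>-\<^sup>m)'' / cosh\<^sup>-\<^sup>m - m\<^sup>2) / m\<close>, for which \<open>cosh\<^sup>-\<^sup>m\<close> solves the eigenvalue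
  equation with eigenvalue \<open>m\<close>.\<close>

definition sech_damping :: "real \<Rightarrow> real \<Rightarrow> complex" where
  "sech_damping m x = of_real (- (1 + m) * (1 - (tanh x)\<^sup>2))"

lemma sech_damping:
  assumes m: "m > 0"
  shows "ess_bounded (sech_damping m)" "integrable lebesgue (sech_damping m)"
    "(LINT x|lebesgue. cmod (sech_damping m x)) = 2 * (1 + m)"
proof -
  have sq: "0 \<le> 1 - (tanh x)\<^sup>2" for x :: real
    using tanh_real_lt_1[of x] tanh_real_gt_neg1[of x] by (simp add: abs_square_le_1 abs_le_iff)
  have norm: "cmod (sech_damping m x) = (1 + m) * (1 - (tanh x)\<^sup>2)" for x
    using m sq[of x] unfolding sech_damping_def norm_of_real by (simp add: abs_mult)
  have cont: "continuous_on UNIV (\<lambda>x::real. 1 - (tanh x)\<^sup>2)"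
    by (auto intro!: continuous_intros)
  have meas: "sech_damping m \<in> borel_measurable lebesgue"
    unfolding sech_damping_def[abs_def]
    by (intro continuous_borel_measurable_lebesgue continuous_on_of_real continuous_on_mult
        continuous_on_const cont)
  have int: "integrable lebesgue (\<lambda>x::real. 1 - (tanh x)\<^sup>2)"
    and LINT: "(LINT x|lebesgue. 1 - (tanh (x::real))\<^sup>2) = 1 - (-1)"
  proof -
    have "(tanh has_real_derivative 1 - (tanh x)\<^sup>2) (at x)" for x :: real
      by (auto intro!: derivative_eq_intros)
    note * = FTC_UNIV_nonneg[OF this cont sq tanh_real_at_bot tanh_real_at_top]
    show "integrable lebesgue (\<lambda>x::real. 1 - (tanh x)\<^sup>2)"
      "(LINT x|lebesgue. 1 - (tanh (x::real))\<^sup>2) = 1 - (-1)" by (rule *)+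
  qed
  show "ess_bounded (sech_damping m)"
    unfolding ess_bounded_def
  proof (intro conjI exI[of _ "1 + m"] meas AE_I2)
    show "cmod (sech_damping m x) \<le> 1 + m" for x
      unfolding norm using m mult_left_mono[of "1 - (tanh x)\<^sup>2" 1 "1 + m"] by simp
  qed
  have "integrable lebesgue (\<lambda>x::real. - (1 + m) * (1 - (tanh x)\<^sup>2))"
    by (intro integrable_mult_right int)
  then show "integrable lebesgue (sech_damping m)"
    unfolding sech_damping_def[abs_def] by (rule integrable_of_real)
  have "(LINT x|lebesgue. (1 + m) * (1 - (tanh (x::real))\<^sup>2)) = (1 + m) * 2"
    using LINT by simp
  then show "(LINT x|lebesgue. cmod (sech_damping m x)) = 2 * (1 + m)"
    by (simp only: norm mult.commute)
qed

text \<open>In terms of the polynomials \<open>P\<close> above, the eigenfunction \<open>u\<close> and its first two derivatives have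
  \<open>P = 1\<close>, \<open>P = - m t\<close> and \<open>P = (m + m\<^sup>2) t\<^sup>2 - m\<close>. The function \<open>w = m u\<close> is the second component of
  the eigenvector.\<close>

theorem sech_damping_eigenvalue:
  assumes m: "m > 0"
  shows "of_real m \<in> point_spectrum (damped_wave_operator (sech_damping m))"
proof -
  define u where "u x = complex_of_real (sech_poly m 1 x)" for x
  define u' where "u' x = complex_of_real (sech_poly m [:0, - m:] x)" for x
  define u'' where "u'' x = complex_of_real (sech_poly m [:- m, 0, m + m\<^sup>2:] x)" for x
  have ddx_u: "ddx u = u'"
    unfolding u_def u'_def
    using ddx_eqI[OF has_vector_derivative_sech_poly[of m 1]] by (simp add: pderiv_1)
  have ddx_u': "ddx u' = u''"
    unfolding u'_def u''_def
    using ddx_eqI[OF has_vector_derivative_sech_poly[of m "[:0, - m:]"]]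
    by (simp add: pderiv_pCons power2_eq_square)
  have smooth: "smooth u" "smooth u'"
    unfolding u_def u'_def by (rule smooth_sech_poly)+
  have sq: "square_integrable u" "square_integrable u'" "square_integrable u''"
    unfolding u_def u'_def u''_def by (rule square_integrable_sech_poly[OF m])+
  obtain \<phi> where test: "\<And>n::nat. test_function (\<phi> n)"
    and lim: "(\<lambda>n. L2_norm (\<lambda>x. \<phi> n x - u x)) \<longlonglongrightarrow> 0"
    and lim': "(\<lambda>n. L2_norm (\<lambda>x. ddx (\<phi> n) x - u' x)) \<longlonglongrightarrow> 0"
  proof (rule test_functions_approximate_smooth[OF smooth(1) sq(1)], goal_cases)
    case 1 then show ?case using sq(2) by (simp add: ddx_u)
  next
    case (2 \<phi>) then show ?case using 2(1)[OF 2(2,3)] by (simp add: ddx_u)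
  qed
  have Cauchy: "grad_Cauchy \<phi>"
    by (rule grad_Cauchy_if_L2_convergent[OF test sq(2) lim'])
  let ?\<mu> = "complex_of_real m" and ?a = "sech_damping m"
  define \<psi> where "\<psi> = abs_Hdot1 \<phi>"
  define w where "w x = ?\<mu> * u x" for x
  define w' where "w' x = ?\<mu> * u' x" for x
  have sw: "smooth w" unfolding w_def by (rule smooth_cmult[OF smooth(1)])
  have ddx_w: "ddx w = w'"
    unfolding w_def w'_def using ddx_scale[of u] smooth_differentiable[OF smooth(1)] ddx_u by simp
  have sq_w: "square_integrable w" "square_integrable w'"
    unfolding w_def w'_def by (intro square_integrable_scale sq)+
  have test_\<mu>: "test_function (\<lambda>x. ?\<mu> * \<phi> n x)" for n by (rule test_function_scale[OF test])
  have ddx_\<mu>: "ddx (\<lambda>x. ?\<mu> * \<phi> n x) = (\<lambda>x. ?\<mu> * ddx (\<phi> n) x)" for n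
    by (rule ddx_scale[OF test_function_differentiable[OF test]])
  have grad: "gradient \<psi> (abs_L2 u')"
    unfolding gradient_def \<psi>_def
    by (intro exI[of _ \<phi>] conjI Cauchy refl L2_tendsto_abs sq lim'
        test_function_ddx_square_integrable test)
  have lap: "laplacian \<psi> (abs_L2 u'')"
    unfolding laplacian_def
    using grad weak_derivative_smooth[OF smooth(2) sq(2)] sq(3) ddx_u' by auto
  have weak_w: "weak_derivative (abs_L2 w) (abs_L2 w')"
    using weak_derivative_smooth[OF sw sq_w(1)] sq_w(2) ddx_w by simp
  have incl: "H1_inclusion (abs_L2 w) (scale_Hdot1 ?\<mu> \<psi>)"
    unfolding H1_inclusion_def
  proof (intro exI conjI)
    show "grad_Cauchy (\<lambda>n x. ?\<mu> * \<phi> n x)" by (rule grad_Cauchy_scale[OF Cauchy])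
    show "scale_Hdot1 ?\<mu> \<psi> = abs_Hdot1 (\<lambda>n x. ?\<mu> * \<phi> n x)"
      unfolding \<psi>_def by (rule scale_abs_Hdot1[OF Cauchy])
    show "weak_derivative (abs_L2 w) (abs_L2 w')" by (rule weak_w)
    show "L2_tendsto (\<lambda>n x. ?\<mu> * \<phi> n x) (abs_L2 w)"
    proof (rule L2_tendsto_abs[OF test_function_square_integrable[OF test_\<mu>] sq_w(1)])
      have "L2_norm (\<lambda>x. ?\<mu> * \<phi> n x - w x) = cmod ?\<mu> * L2_norm (\<lambda>x. \<phi> n x - u x)" for n
        using L2_norm_scale[of ?\<mu> "\<lambda>x. \<phi> n x - u x"] by (simp add: w_def right_diff_distrib)
      then show "(\<lambda>n. L2_norm (\<lambda>x. ?\<mu> * \<phi> n x - w x)) \<longlonglongrightarrow> 0"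
        using tendsto_mult_right_zero[OF lim] by simp
    qed
    show "L2_tendsto (\<lambda>n. ddx (\<lambda>x. ?\<mu> * \<phi> n x)) (abs_L2 w')"
    proof (rule L2_tendsto_abs[OF test_function_ddx_square_integrable[OF test_\<mu>] sq_w(2)])
      have "L2_norm (\<lambda>x. ddx (\<lambda>x. ?\<mu> * \<phi> n x) x - w' x) = cmod ?\<mu> * L2_norm (\<lambda>x. ddx (\<phi> n) x - u' x)" for n
        using L2_norm_scale[of ?\<mu> "\<lambda>x. ddx (\<phi> n) x - u' x"]
        by (simp add: w'_def ddx_\<mu> right_diff_distrib)
      then show "(\<lambda>n. L2_norm (\<lambda>x. ddx (\<lambda>x. ?\<mu> * \<phi> n x) x - w' x)) \<longlonglongrightarrow> 0"
        using tendsto_mult_right_zero[OF lim'] by simp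
    qed
  qed
  have ode: "?\<mu> * w x = u'' x - ?a x * w x" for x
  proof -
    have "m * (m * sech_poly m 1 x)
        = sech_poly m [:- m, 0, m + m\<^sup>2:] x - (- (1 + m) * (1 - (tanh x)\<^sup>2)) * (m * sech_poly m 1 x)"
      by (simp add: sech_poly_def algebra_simps power2_eq_square)
    then show ?thesis
      unfolding w_def u_def u''_def sech_damping_def
      by (simp only: of_real_mult[symmetric] of_real_diff[symmetric])
  qed
  have eq: "scale_L2 ?\<mu> (abs_L2 w) = abs_L2 u'' - mult_L2 ?a (abs_L2 w)"
  proof (rule L2_eqI)
    show "AE x in lebesgue. rep_L2 (scale_L2 ?\<mu> (abs_L2 w)) x
        = rep_L2 (abs_L2 u'' - mult_L2 ?a (abs_L2 w)) x"
      using rep_scale_L2[of ?\<mu> "abs_L2 w"] rep_minus_L2[of "abs_L2 u''" "mult_L2 ?a (abs_L2 w)"]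
        rep_mult_L2[OF sech_damping(1)[OF m], of "abs_L2 w"]
        rep_abs_L2[OF sq_w(1)] rep_abs_L2[OF sq(3)]
      by eventually_elim (simp add: ode)
  qed
  have "abs_L2 w \<noteq> 0"
  proof
    assume "abs_L2 w = 0"
    then have "AE x in lebesgue. rep_L2 (abs_L2 w) x = 0" using rep_zero_L2 by simp
    then have "AE x in (lebesgue :: real measure). False"
      using rep_abs_L2[OF sq_w(1)]
    proof eventually_elim
      case (elim x)
      then show False using m cosh_real_pos[of x] by (simp add: w_def u_def sech_poly_def)
    qed
    then show False by (simp add: eventually_False ae_filter_eq_bot_iff)
  qed
  then have "(\<psi>, abs_L2 w) \<noteq> 0" by (simp add: zero_prod_def)
  moreover have "((\<psi>, abs_L2 w), scale_energy ?\<mu> (\<psi>, abs_L2 w)) \<in> damped_wave_operator ?a"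
    unfolding damped_wave_operator_def scale_energy.simps eq
    using lap incl weak_w by (auto simp: H1_def)
  ultimately show ?thesis
    unfolding point_spectrum_def by blast
qed

section \<open>The sharp constant\<close>

theorem theorem4:
  shows "(\<forall>a :: real \<Rightarrow> complex.
            ess_bounded a \<and> integrable lebesgue a \<and> (LINT x|lebesgue. cmod (a x)) < 2 \<longrightarrow>
            point_spectrum (damped_wave_operator a) = {}) \<and>
         (\<forall>c :: real. c > 2 \<longrightarrow>
            (\<exists>a :: real \<Rightarrow> complex.
               ess_bounded a \<and> integrable lebesgue a \<and> (LINT x|lebesgue. cmod (a x)) < c \<and>
               point_spectrum (damped_wave_operator a) \<noteq> {}))"
proof (intro conjI allI impI)
  fix a :: "real \<Rightarrow> complex"
  assume "ess_bounded a \<and> integrable lebesgue a \<and> (LINT x|lebesgue. cmod (a x)) < 2"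
  then show "point_spectrum (damped_wave_operator a) = {}"
    by (intro point_spectrum_empty) auto
next
  fix c :: real assume c: "c > 2"
  \<comment> \<open>Then \<open>2 (1 + m)\<close> is the midpoint of \<open>2\<close> and \<open>c\<close>.\<close>
  define m where "m = (c - 2) / 4"
  have m: "m > 0" "2 * (1 + m) < c" using c by (simp_all add: m_def field_simps)
  show "\<exists>a. ess_bounded a \<and> integrable lebesgue a \<and> (LINT x|lebesgue. cmod (a x)) < c \<and>
      point_spectrum (damped_wave_operator a) \<noteq> {}"
    using sech_damping[OF m(1)] sech_damping_eigenvalue[OF m(1)] m(2)
    by (intro exI[of _ "sech_damping m"]) auto
qed

end
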